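(* Let $A_0=\mathrm{diag}(\lambda_1,\dots,\lambda_n)$ with pairwise distinct $\lambda_i\in\mathbb C$, let $A_1$ be a complex $n\times n$ matrix with diagonal entries $\lambda'_1,\dots,\lambda'_n$ (arbitrary complex numbers), let $\eta$ be admissible, $\lambda\in\mathcal P_\eta$, and let $q\ge0$ be an integer. Write $N_k=\lambda'_k$ when $\lambda'_k\in\mathbb N$. Let $\alpha_j=2\pi i$ when $\lambda'_j\in\mathbb Z$ and $\alpha_j=e^{-2\pi i\lambda'_j}-1$ when $\lambda'_j\notin\mathbb Z$. The following transformations hold for a (small, anticlockwise) loop around a pole $\lambda_j$. (a) If $\lambda'_k\notin\mathbb Z$ or $\lambda'_k\in\mathbb Z_-$: $$\vec\Psi_k^{[-q]}(\lambda)\longmapsto\vec\Psi_k^{[-q]}(\lambda)+\begin{cases}\alpha_jc_{jk}\,\vec\Psi_j^{[-q]}(\lambda),&\lambda'_j\notin\mathbb Z\text{ or }\lambda'_j\in\mathbb Z_-,\\ \alpha_jc_{jk}\,\hat\Psi_j^{[-q+N_j+1]}(\lambda),&\lambda'_j\in\mathbb N.\end{cases}$$ (b) If $\lambda'_k\in\mathbb N$: $$\hat\Psi_k^{[-q]}(\lambda)\longmapsto\hat\Psi_k^{[-q]}(\lambda)+\begin{cases}\alpha_jc_{jk}\,\vec\Psi_j^{[-q-1-N_k]}(\lambda),&\lambda'_j\notin\mathbb Z\text{ or }\lambda'_j\in\mathbb Z_-,\\ \alpha_jc_{jk}\,\hat\Psi_j^{[-q+N_j-N_k]}(\lambda),&\lambda'_j\in\mathbb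 N.\end{cases}$$
   Context: Systems. (R): $\frac{dY}{dz}=(A_0+A_1/z)Y$. (F): $(A_0-\lambda)\frac{d\Psi}{d\lambda}=(A_1+I)\Psi$. $\mathbb N=\{0,1,2,\dots\}$, $\mathbb Z_-=\{-1,-2,\dots\}$, $\vec e_k$ is the $k$-th unit column vector; $\mathrm{reg}(\lambda-\lambda_j)$ denotes any vector function analytic in a neighbourhood of $\lambda_j$. $B_k=-E_k(A_1+I)$, where $E_k$ has the single nonzero entry $(E_k)_{kk}=1$, is the residue at $\lambda_k$ of (F) written as $\Psi'=\sum_jB_j\Psi/(\lambda-\lambda_j)$. Cuts. $\eta\in\mathbb R$ is admissible if $\eta\neq\arg(\lambda_j-\lambda_k)$ mod $2\pi$ for all $j\ne k$. For admissible $\eta$, $L_k$ is the ray from $\lambda_k$ to $\infty$ in direction $\eta$, and $\mathcal P_\eta$ is the plane cut along $L_1,\dots,L_n$, with the branches $\eta-2\pi<\arg(\lambda-\lambda_k)<\eta$ used for all powers and logarithms of $\lambda-\lambda_k$. Loops start in $\mathcal P_\eta$ near $\lambda_j$, encircle no other pole and cross only the cut $L_j$. Coefficients. With $\Lambda'=\mathrm{diag}(\lambda'_1,\dots,\lambda'_n)$, (R) has a unique formal solution $\bigl(I+\sum_{l\ge1}F_lz^{-l}\bigr)e^{A_0z}z^{\Lambda'}$; $\vec f_l^{(k)}$ is the $k$-th column of $F_l$, and $\vec f_0^{(k)}=\vec e_k$. Solutions $\vec\Psi_k$ of (F) on $\mathcal P_\eta$ (series near $\lambda_k$, continued to $\mathcal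 P_\eta$): - $\lambda'_k\notin\mathbb Z$: $\vec\Psi_k=\sum_{l\ge0}\Gamma(\lambda'_k+1-l)\vec f_l^{(k)}(\lambda-\lambda_k)^{l-\lambda'_k-1}$; - $\lambda'_k=N_k\in\mathbb Z_-$: $\vec\Psi_k=\sum_{l\ge0}\frac{(-1)^{l-N_k}}{(l-N_k-1)!}\vec f_l^{(k)}(\lambda-\lambda_k)^{l-N_k-1}$; - $\lambda'_k=N_k\in\mathbb N$: $\vec\Psi_k=\sum_{l\ge0}\frac{(-1)^{l+1}}{l!}\vec f^{(k)}_{N_k+l+1}(\lambda-\lambda_k)^l$; in this case (F) has a solution of the form $\vec\Psi_k\ln(\lambda-\lambda_k)+\frac{P^{(k)}_{N_k}(\lambda)}{(\lambda-\lambda_k)^{N_k+1}}+\mathrm{reg}(\lambda-\lambda_k)$ with $P^{(k)}_{N_k}(\lambda)=\sum_{l=0}^{N_k}(N_k-l)!\,\vec f_l^{(k)}(\lambda-\lambda_k)^l$. Singular solutions: $\vec\Psi_k^{(sing)}=\vec\Psi_k$ if $\lambda'_k\notin\mathbb Z$; the solution of the form just displayed if $\lambda'_k\in\mathbb N$; if $\lambda'_k=-1$, a solution of the form $\vec\Psi_k\ln(\lambda-\lambda_k)+\mathrm{reg}(\lambda-\lambda_k)$ (for $\lambda'_k=-1$ the matrix $B_k$ is taken to have a nontrivial Jordan block, so that such a solution exists); if $\lambda'_k\in\{-2,-3,\dots\}$, a solution of the form $\vec\Psi_k\ln(\lambda-\lambda_k)+\mathrm{reg}(\lambda-\lambda_k)$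 if one exists, and $\vec\Psi_k^{(sing)}\equiv0$ otherwise. Connection coefficients $c_{jk}$ are the unique numbers with $\vec\Psi_k=\vec\Psi_j^{(sing)}c_{jk}+\mathrm{reg}(\lambda-\lambda_j)$ near $\lambda_j$ in $\mathcal P_\eta$, with $c_{jk}:=0$ for all $k$ when $\lambda'_j\in\{-2,-3,\dots\}$ and $\vec\Psi_j^{(sing)}\equiv0$. $q$-primitives ($q\in\mathbb N$), defined near $\lambda_k$ by convergent series and continued analytically to $\mathcal P_\eta$: - $\lambda'_k\notin\mathbb Z$: $\vec\Psi_k^{[-q]}=(-1)^q\sum_{l\ge q}\Gamma(\lambda'_k+1-l)\vec f^{(k)}_{l-q}(\lambda-\lambda_k)^{l-\lambda'_k-1}$; - $\lambda'_k=N_k\in\mathbb Z_-$: $\vec\Psi_k^{[-q]}=(-1)^q\sum_{l\ge q}\frac{(-1)^{l-N_k}}{(l-N_k-1)!}\vec f^{(k)}_{l-q}(\lambda-\lambda_k)^{l-N_k-1}$; - $\lambda'_k=N_k\in\mathbb N$: $\hat\Psi_k=\sum_{l\ge0}\frac{(-1)^{l+N_k}}{l!}\vec f_l^{(k)}(\lambda-\lambda_k)^l$, $\hat\Psi_k^{[-q]}=(-1)^q\sum_{l\ge q}\frac{(-1)^{l+N_k}}{l!}\vec f^{(k)}_{l-q}(\lambda-\lambda_k)^l$, and for an integer $r\ge0$, $\hat\Psi_k^{[r]}=\frac{d^r}{d\lambda^r}\hat\Psi_k$ (so $\hat\Psi_k^{[N_k+1]}=\vec\Psi_k$). *)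

theory Defs
  imports "HOL-Complex_Analysis.Complex_Analysis"
begin

section \<open>Vector-valued functions of a complex variable\<close>

definition vholomorphic_on :: "(complex \<Rightarrow> complex^'n) \<Rightarrow> complex set \<Rightarrow> bool"
    (infixl \<open>vholomorphic'_on\<close> 50) where
  "f vholomorphic_on S \<longleftrightarrow> (\<forall>i. (\<lambda>z. f z $ i) holomorphic_on S)"

definition vanalytic_at :: "(complex \<Rightarrow> complex^'n) \<Rightarrow> complex \<Rightarrow> bool" where
  "vanalytic_at f a \<longleftrightarrow> (\<forall>i. (\<lambda>z. f z $ i) analytic_on {a})"

definition vderiv :: "(complex \<Rightarrow> complex^'n) \<Rightarrow> complex \<Rightarrow> complex^'n" where
  "vderiv f z = (\<chi> i. deriv (\<lambda>w. f w $ i) z)"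

text \<open>Analytic continuation along a path: a family of function elements \<open>G t\<close> at \<open>\<gamma> t\<close>
  such that neighbouring elements agree as germs, starting with the germ of \<open>f\<close> at \<open>\<gamma> 0\<close>
  and ending with the germ of \<open>g\<close> at \<open>\<gamma> 1\<close>.\<close>

definition continuation_along ::
    "(real \<Rightarrow> complex) \<Rightarrow> (complex \<Rightarrow> complex^'n) \<Rightarrow> (complex \<Rightarrow> complex^'n) \<Rightarrow> bool" where
  "continuation_along \<gamma> f g \<longleftrightarrow>
     (\<exists>G :: real \<Rightarrow> complex \<Rightarrow> complex^'n.
        (\<forall>t\<in>{0..1}. vanalytic_at (G t) (\<gamma> t)) \<and>
        (\<forall>t\<in>{0..1}. \<exists>\<delta>>0. \<forall>s\<in>{0..1}. \<bar>s - t\<bar> < \<delta> \<longrightarrow>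
            (\<forall>\<^sub>F z in nhds (\<gamma> s). G s z = G t z)) \<and>
        (\<forall>\<^sub>F z in nhds (\<gamma> 0). G 0 z = f z) \<and>
        (\<forall>\<^sub>F z in nhds (\<gamma> 1). G 1 z = g z))"

text \<open>The transformation \<open>f \<mapsto> g\<close> of functions on \<open>P\<close> induced by a loop \<open>\<gamma>\<close> based in \<open>P\<close>:
  the germ of \<open>f\<close> at the base point is continued along \<open>\<gamma>\<close>, and the resulting germ is
  extended to a holomorphic function \<open>h\<close> on \<open>P\<close>, which is \<open>g\<close>.\<close>

definition loop_transform ::
    "complex set \<Rightarrow> (real \<Rightarrow> complex) \<Rightarrow> (complex \<Rightarrow> complex^'n) \<Rightarrow> (complex \<Rightarrow> complex^'n) \<Rightarrow> bool" where
  "loop_transform P \<gamma> f g \<longleftrightarrow>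
     (\<exists>h. h vholomorphic_on P \<and> continuation_along \<gamma> f h \<and> (\<forall>z\<in>P. h z = g z))"

text \<open>\<open>f\<close> is the analytic continuation to \<open>P\<close> of the function given near \<open>a\<close> by the
  convergent series with terms \<open>u l\<close>.\<close>

definition continues_series ::
    "complex set \<Rightarrow> complex \<Rightarrow> (nat \<Rightarrow> complex \<Rightarrow> complex^'n) \<Rightarrow> (complex \<Rightarrow> complex^'n) \<Rightarrow> bool" where
  "continues_series P a u f \<longleftrightarrow>
     f vholomorphic_on P \<and> (\<exists>\<epsilon>>0. \<forall>z \<in> P \<inter> ball a \<epsilon>. (\<lambda>l. u l z) sums f z)"

text \<open>\<open>f = g + reg (\<lambda> - a)\<close> near \<open>a\<close> in \<open>P\<close>.\<close>

definition eq_mod_reg ::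
    "complex set \<Rightarrow> complex \<Rightarrow> (complex \<Rightarrow> complex^'n) \<Rightarrow> (complex \<Rightarrow> complex^'n) \<Rightarrow> bool" where
  "eq_mod_reg P a f g \<longleftrightarrow>
     (\<exists>r. vanalytic_at r a \<and> (\<exists>\<epsilon>>0. \<forall>z \<in> P \<inter> ball a \<epsilon>. f z = g z + r z))"


section \<open>Cuts and branches\<close>

definition admissible :: "('n \<Rightarrow> complex) \<Rightarrow> real \<Rightarrow> bool" where
  "admissible lam \<eta> \<longleftrightarrow>
     (\<forall>j k. j \<noteq> k \<longrightarrow> (\<forall>m::int. \<eta> \<noteq> Arg (lam j - lam k) + 2 * pi * of_int m))"

definition cut :: "('n \<Rightarrow> complex) \<Rightarrow> real \<Rightarrow> 'n \<Rightarrow> complex set" where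
  "cut lam \<eta> k = {lam k + of_real t * cis \<eta> | t. t \<ge> 0}"

definition cut_plane :: "('n \<Rightarrow> complex) \<Rightarrow> real \<Rightarrow> complex set" where
  "cut_plane lam \<eta> = - (\<Union>k. cut lam \<eta> k)"

text \<open>The principal branch \<open>Ln\<close> has imaginary part in \<open>(-\<pi>, \<pi>]\<close>. Rotating by \<open>\<eta> - \<pi>\<close> gives the
  branch with imaginary part in \<open>(\<eta> - 2\<pi>, \<eta>]\<close>, the value \<open>\<eta>\<close> being taken only on the ray of
  direction \<open>\<eta>\<close>, that is, outside the cut plane.\<close>

definition cut_log :: "real \<Rightarrow> complex \<Rightarrow> complex" where
  "cut_log \<eta> x = Ln (x * cis (pi - \<eta>)) + \<i> * of_real (\<eta> - pi)"

definition cut_pow :: "real \<Rightarrow> complex \<Rightarrow> complex \<Rightarrow> complex" where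
  "cut_pow \<eta> x a = exp (a * cut_log \<eta> x)"

text \<open>Anticlockwise loops around \<open>lam j\<close>; ``small'' means contained in a disc about \<open>lam j\<close> that
  meets none of the other cuts (and hence contains no other pole).\<close>

definition small_loop :: "('n \<Rightarrow> complex) \<Rightarrow> real \<Rightarrow> 'n \<Rightarrow> (real \<Rightarrow> complex) \<Rightarrow> bool" where
  "small_loop lam \<eta> j \<gamma> \<longleftrightarrow>
     path \<gamma> \<and> pathfinish \<gamma> = pathstart \<gamma> \<and> pathstart \<gamma> \<in> cut_plane lam \<eta> \<and>
     (\<exists>r>0. (\<forall>k. k \<noteq> j \<longrightarrow> ball (lam j) r \<inter> cut lam \<eta> k = {}) \<and>
            path_image \<gamma> \<subseteq> ball (lam j) r - {lam j}) \<and>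
     winding_number \<gamma> (lam j) = 1"


section \<open>The two systems\<close>

definition diag :: "('n \<Rightarrow> 'a::zero) \<Rightarrow> 'a^'n^'n" where
  "diag d = (\<chi> i j. if i = j then d i else 0)"

definition fps_mat :: "complex^'n^'n \<Rightarrow> complex fps^'n^'n" where
  "fps_mat A = (\<chi> i j. fps_const (A $ i $ j))"

text \<open>A formal series in \<open>1/z\<close> is a power series in \<open>fps_X\<close>, which stands for \<open>1/z\<close>; then \<open>d/dz\<close> is
  \<open>- fps_X\<^sup>2 * fps_deriv\<close>. Inserting \<open>Y = F e\<^bsup>A\<^sub>0 z\<^esup> z\<^bsup>\<Lambda>'\<^esup>\<close> with \<open>F = I + O(1/z)\<close> into
  \<open>dY/dz = (A\<^sub>0 + A\<^sub>1/z) Y\<close> and cancelling the invertible factor \<open>e\<^bsup>A\<^sub>0 z\<^esup> z\<^bsup>\<Lambda>'\<^esup>\<close> gives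
  \<open>dF/dz + F (A\<^sub>0 + \<Lambda>'/z) = (A\<^sub>0 + A\<^sub>1/z) F\<close>, where \<open>\<Lambda>'\<close> is the diagonal part of \<open>A\<^sub>1\<close>.\<close>

definition formal_solution ::
    "('n::finite \<Rightarrow> complex) \<Rightarrow> complex^'n^'n \<Rightarrow> complex fps^'n^'n \<Rightarrow> bool" where
  "formal_solution lam A1 F \<longleftrightarrow>
     (\<forall>i j. fps_nth (F $ i $ j) 0 = (if i = j then 1 else 0)) \<and>
     (\<chi> i j. - (fps_X ^ 2) * fps_deriv (F $ i $ j))
       + F ** (fps_mat (diag lam) + mat fps_X ** fps_mat (diag (\<lambda>k. A1 $ k $ k)))
     = (fps_mat (diag lam) + mat fps_X ** fps_mat A1) ** F"

definition fcol :: "complex fps^'n^'n \<Rightarrow> 'n \<Rightarrow> nat \<Rightarrow> complex^'n" where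
  "fcol F k l = (\<chi> i. fps_nth (F $ i $ k) l)"

definition solves_F ::
    "('n::finite \<Rightarrow> complex) \<Rightarrow> complex^'n^'n \<Rightarrow> complex set \<Rightarrow> (complex \<Rightarrow> complex^'n) \<Rightarrow> bool" where
  "solves_F lam A1 P f \<longleftrightarrow>
     f vholomorphic_on P \<and>
     (\<forall>z\<in>P. (diag lam - mat z) *v vderiv f z = (A1 + mat 1) *v f z)"

definition residue_mat :: "complex^'n^'n \<Rightarrow> 'n::finite \<Rightarrow> complex^'n^'n" where
  "residue_mat A1 k = - ((\<chi> i j. if i = k \<and> j = k then 1 else 0) ** (A1 + mat 1))"

text \<open>A Jordan block of size at least two is the same as a Jordan chain \<open>w, v\<close> of length two.\<close>

definition has_nontrivial_jordan_block :: "complex^'n^'n \<Rightarrow> bool" where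
  "has_nontrivial_jordan_block B \<longleftrightarrow>
     (\<exists>\<mu> v w. v \<noteq> 0 \<and> B *v v = \<mu> *s v \<and> B *v w = \<mu> *s w + v)"


section \<open>Solutions at the poles\<close>

definition negative_Ints :: "complex set" where
  "negative_Ints = {of_int m | m. m < 0}"

text \<open>\<open>N\<^sub>k\<close>; only meaningful when \<open>\<lambda>'\<^sub>k\<close> is an integer.\<close>

definition NN :: "complex^'n^'n \<Rightarrow> 'n \<Rightarrow> int" where
  "NN A1 k = \<lfloor>Re (A1 $ k $ k)\<rfloor>"

text \<open>The \<open>l\<close>-th term of the series of \<open>\<Psi>\<^sub>k\<^bsup>[-q]\<^esup>\<close> for \<open>\<lambda>'\<^sub>k\<close> not in \<open>\<nat>\<close>.\<close>

definition Psi_prim_term ::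
    "('n \<Rightarrow> complex) \<Rightarrow> complex^'n^'n \<Rightarrow> real \<Rightarrow> complex fps^'n^'n \<Rightarrow> nat \<Rightarrow> 'n \<Rightarrow> nat
      \<Rightarrow> complex \<Rightarrow> complex^'n" where
  "Psi_prim_term lam A1 \<eta> F q k l z =
     (if l < q then 0
      else if A1 $ k $ k \<notin> \<int> then
        ((-1) ^ q * Gamma (A1 $ k $ k + 1 - of_nat l)
           * cut_pow \<eta> (z - lam k) (of_nat l - A1 $ k $ k - 1)) *s fcol F k (l - q)
      else
        ((-1) ^ q * ((-1) ^ nat (int l - NN A1 k) / fact (nat (int l - NN A1 k - 1)))
           * (z - lam k) ^ nat (int l - NN A1 k - 1)) *s fcol F k (l - q))"

text \<open>The \<open>l\<close>-th term of the series of \<open>\<Psi>\<^sub>k\<close>. For \<open>\<lambda>'\<^sub>k\<close> not in \<open>\<nat>\<close> this is the case \<open>q = 0\<close> above.\<close>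

definition Psi_term ::
    "('n \<Rightarrow> complex) \<Rightarrow> complex^'n^'n \<Rightarrow> real \<Rightarrow> complex fps^'n^'n \<Rightarrow> 'n \<Rightarrow> nat
      \<Rightarrow> complex \<Rightarrow> complex^'n" where
  "Psi_term lam A1 \<eta> F k l z =
     (if A1 $ k $ k \<in> \<nat> then
        ((-1) ^ (l + 1) / fact l * (z - lam k) ^ l) *s fcol F k (nat (NN A1 k) + l + 1)
      else Psi_prim_term lam A1 \<eta> F 0 k l z)"

text \<open>The \<open>l\<close>-th term of the series whose sum is the \<open>q\<close>-primitive of the hatted function,
  for \<open>\<lambda>'\<^sub>k\<close> in \<open>\<nat>\<close>.\<close>

definition hat_prim_term ::
    "('n \<Rightarrow> complex) \<Rightarrow> complex^'n^'n \<Rightarrow> complex fps^'n^'n \<Rightarrow> nat \<Rightarrow> 'n \<Rightarrow> nat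
      \<Rightarrow> complex \<Rightarrow> complex^'n" where
  "hat_prim_term lam A1 F q k l z =
     (if l < q then 0
      else ((-1) ^ q * ((-1) ^ (l + nat (NN A1 k)) / fact l) * (z - lam k) ^ l) *s fcol F k (l - q))"

text \<open>The hatted functions with integer superscript \<open>s\<close>, given the \<open>q\<close>-primitives \<open>hat q k\<close>: primitives
  for \<open>s \<le> 0\<close>, derivatives for \<open>s \<ge> 0\<close>.\<close>

definition hat_bracket ::
    "(nat \<Rightarrow> 'n \<Rightarrow> complex \<Rightarrow> complex^'n) \<Rightarrow> 'n \<Rightarrow> int \<Rightarrow> complex \<Rightarrow> complex^'n" where
  "hat_bracket hat k s = (if s \<le> 0 then hat (nat (- s)) k else (vderiv ^^ nat s) (hat 0 k))"

definition is_Psi ::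
    "('n \<Rightarrow> complex) \<Rightarrow> complex^'n^'n \<Rightarrow> real \<Rightarrow> complex fps^'n^'n \<Rightarrow> 'n
      \<Rightarrow> (complex \<Rightarrow> complex^'n) \<Rightarrow> bool" where
  "is_Psi lam A1 \<eta> F k f \<longleftrightarrow>
     continues_series (cut_plane lam \<eta>) (lam k) (Psi_term lam A1 \<eta> F k) f"

definition is_Psi_prim ::
    "('n \<Rightarrow> complex) \<Rightarrow> complex^'n^'n \<Rightarrow> real \<Rightarrow> complex fps^'n^'n \<Rightarrow> nat \<Rightarrow> 'n
      \<Rightarrow> (complex \<Rightarrow> complex^'n) \<Rightarrow> bool" where
  "is_Psi_prim lam A1 \<eta> F q k f \<longleftrightarrow>
     continues_series (cut_plane lam \<eta>) (lam k) (Psi_prim_term lam A1 \<eta> F q k) f"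

definition is_hat_prim ::
    "('n \<Rightarrow> complex) \<Rightarrow> complex^'n^'n \<Rightarrow> real \<Rightarrow> complex fps^'n^'n \<Rightarrow> nat \<Rightarrow> 'n
      \<Rightarrow> (complex \<Rightarrow> complex^'n) \<Rightarrow> bool" where
  "is_hat_prim lam A1 \<eta> F q k f \<longleftrightarrow>
     continues_series (cut_plane lam \<eta>) (lam k) (hat_prim_term lam A1 F q k) f"


section \<open>Singular solutions and connection coefficients\<close>

definition polar_part ::
    "('n \<Rightarrow> complex) \<Rightarrow> complex^'n^'n \<Rightarrow> complex fps^'n^'n \<Rightarrow> 'n \<Rightarrow> complex \<Rightarrow> complex^'n" where
  "polar_part lam A1 F k z =
     (1 / (z - lam k) ^ (nat (NN A1 k) + 1)) *s
       (\<Sum>l = 0..nat (NN A1 k). (fact (nat (NN A1 k) - l) * (z - lam k) ^ l) *s fcol F k l)"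

definition log_solution ::
    "('n::finite \<Rightarrow> complex) \<Rightarrow> complex^'n^'n \<Rightarrow> real \<Rightarrow> complex fps^'n^'n \<Rightarrow> 'n
      \<Rightarrow> (complex \<Rightarrow> complex^'n) \<Rightarrow> (complex \<Rightarrow> complex^'n) \<Rightarrow> bool" where
  "log_solution lam A1 \<eta> F k \<psi> g \<longleftrightarrow>
     solves_F lam A1 (cut_plane lam \<eta>) g \<and>
     eq_mod_reg (cut_plane lam \<eta>) (lam k) g
       (\<lambda>z. cut_log \<eta> (z - lam k) *s \<psi> z
              + (if A1 $ k $ k \<in> \<nat> then polar_part lam A1 F k z else 0))"

text \<open>\<open>g\<close> is a choice of the singular solution at \<open>lam k\<close>, where \<open>\<psi>\<close> is \<open>\<Psi>\<^sub>k\<close>.\<close>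

definition is_Psi_sing ::
    "('n::finite \<Rightarrow> complex) \<Rightarrow> complex^'n^'n \<Rightarrow> real \<Rightarrow> complex fps^'n^'n \<Rightarrow> 'n
      \<Rightarrow> (complex \<Rightarrow> complex^'n) \<Rightarrow> (complex \<Rightarrow> complex^'n) \<Rightarrow> bool" where
  "is_Psi_sing lam A1 \<eta> F k \<psi> g \<longleftrightarrow>
     (if A1 $ k $ k \<notin> \<int> then \<forall>z \<in> cut_plane lam \<eta>. g z = \<psi> z
      else if A1 $ k $ k \<in> \<nat> \<or> A1 $ k $ k = -1 then log_solution lam A1 \<eta> F k \<psi> g
      else if \<exists>h. log_solution lam A1 \<eta> F k \<psi> h then log_solution lam A1 \<eta> F k \<psi> g
      else \<forall>z \<in> cut_plane lam \<eta>. g z = 0)"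

definition connection_coeffs ::
    "('n \<Rightarrow> complex) \<Rightarrow> complex^'n^'n \<Rightarrow> real \<Rightarrow> ('n \<Rightarrow> complex \<Rightarrow> complex^'n)
      \<Rightarrow> ('n \<Rightarrow> complex \<Rightarrow> complex^'n) \<Rightarrow> ('n \<Rightarrow> 'n \<Rightarrow> complex) \<Rightarrow> bool" where
  "connection_coeffs lam A1 \<eta> Psi Psi_sing c \<longleftrightarrow>
     (\<forall>j k. eq_mod_reg (cut_plane lam \<eta>) (lam j) (Psi k) (\<lambda>z. c j k *s Psi_sing j z)) \<and>
     (\<forall>j. A1 $ j $ j \<in> negative_Ints - {-1} \<and> (\<forall>z \<in> cut_plane lam \<eta>. Psi_sing j z = 0)
            \<longrightarrow> (\<forall>k. c j k = 0))"

definition alpha :: "complex^'n^'n \<Rightarrow> 'n \<Rightarrow> complex" where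
  "alpha A1 j = (if A1 $ j $ j \<in> \<int> then 2 * of_real pi * \<i>
                 else exp (- (2 * of_real pi * \<i> * A1 $ j $ j)) - 1)"

end

theory Submission
  imports Defs
begin

text \<open>Put \<open>\<beta>\<^sub>m = - \<lambda>'\<^sub>m - 1\<close> if \<open>\<lambda>'\<^sub>m\<close> is not an integer and \<open>\<beta>\<^sub>m = 0\<close> otherwise. Near \<open>\<lambda>\<^sub>m\<close>
  all the functions involved are \<open>(\<lambda> - \<lambda>\<^sub>m)\<close> to the power \<open>\<beta>\<^sub>m\<close> times a convergent power series, and
  for each \<open>m\<close> they form one sequence of successive primitives of \<open>\<Psi>\<^sub>m\<close>; both parts of the theorem say
  that the \<open>p\<close>-th primitive of \<open>\<Psi>\<^sub>k\<close> acquires \<open>\<alpha>\<^sub>j c\<^sub>j\<^sub>k\<close> times the \<open>p\<close>-th primitive of \<open>\<Psi>\<^sub>j\<close>. For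
  \<open>p = 0\<close> this follows from the local form of \<open>\<Psi>\<^sub>k\<close> at \<open>\<lambda>\<^sub>j\<close>, that is, \<open>c\<^sub>j\<^sub>k\<close> times the singular
  solution plus a regular function. Integrating this repeatedly affects only the regular part: the
  polar terms of the singular solution are such that no new logarithms survive, and the constants of
  integration are single-valued. Since a small loop may leave the discs of convergence, the
  continuation itself is done in the coordinate \<open>w = ln (\<lambda> - \<lambda>\<^sub>j)\<close>, on a half-plane: there the
  pulled-back system (F) is linear with holomorphic coefficients, so \<open>\<Psi>\<^sub>k\<close> extends to all of it, and
  the loop becomes the translation by \<open>2\<pi>i\<close>.\<close>

no_notation fps_nth (infixl \<open>$\<close> 75)

section \<open>Linear differential equations on convex domains\<close>

lemma primitive_vanishing_at:
  fixes f :: "complex \<Rightarrow> complex"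
  assumes "convex S" "open S" "f holomorphic_on S"
  obtains g where "g w0 = 0" "\<And>w. w \<in> S \<Longrightarrow> (g has_field_derivative f w) (at w)"
proof -
  obtain h where h: "\<And>x. x \<in> S \<Longrightarrow> (h has_field_derivative f x) (at x within S)"
    using holomorphic_convex_primitive'[OF assms] by blast
  have "((\<lambda>x. h x - h w0) has_field_derivative f w) (at w)" if "w \<in> S" for w
    using DERIV_diff[OF h[OF that] DERIV_const] by (simp add: at_within_open[OF that assms(2)])
  then show ?thesis
    using that[of "\<lambda>x. h x - h w0"] by simp
qed

text \<open>The usual Picard estimate, by induction along the segment from \<open>w0\<close> to
  \<open>w\<close>: each integration contributes a factor \<open>K\<close> and one power of the
  distance, and the powers integrate to the factorial. The sequence \<open>D\<close> stands for the
  differences of successive iterates, but it may also be constant, which is how uniqueness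
  follows.\<close>

lemma linear_ode_iterates_bound:
  fixes D :: "nat \<Rightarrow> 'n::finite \<Rightarrow> complex \<Rightarrow> complex" and M :: "complex \<Rightarrow> 'n \<Rightarrow> 'n \<Rightarrow> complex"
  assumes S: "convex S" "w0 \<in> S"
    and M: "\<And>w i. w \<in> S \<Longrightarrow> (\<Sum>j\<in>UNIV. norm (M w i j)) \<le> K"
    and C: "\<And>w i. w \<in> S \<Longrightarrow> norm (D 0 i w) \<le> C"
    and der: "\<And>n w i. w \<in> S \<Longrightarrow>
      (D (Suc n) i has_field_derivative (\<Sum>j\<in>UNIV. M w i j * D n j w)) (at w)"
    and zero: "\<And>n i. D (Suc n) i w0 = 0"
    and w: "w \<in> S"
  shows "norm (D n i w) \<le> C * (K * norm (w - w0)) ^ n / fact n"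
  using w
proof (induction n arbitrary: i w)
  case 0
  then show ?case using C by simp
next
  case (Suc n)
  have "0 \<le> (\<Sum>j\<in>UNIV. norm (M w0 i j))"
    by (simp add: sum_nonneg)
  then have K: "K \<ge> 0" using M[OF S(2), of i] by linarith
  have C0: "C \<ge> 0" using C[OF S(2), of i] norm_ge_zero order_trans by blast
  define d where "d = norm (w - w0)"
  define p where "p = (\<lambda>t::real. w0 + of_real t * (w - w0))"
  define u where "u = (\<lambda>t::real. D (Suc n) i (p t))"
  \<comment> \<open>The majorant for the mean value inequality: its derivative is the bound that the
    induction hypothesis gives for the derivative of \<open>u\<close>, and
    \<open>\<phi> 1 - \<phi> 0\<close> is the bound to be shown.\<close>
  define \<phi> where "\<phi> = (\<lambda>t::real. C * (K * d) ^ Suc n / fact (Suc n) * t ^ Suc n)"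
  have pS: "p t \<in> S" if "0 \<le> t" "t \<le> 1" for t
    using convexD_alt[OF S(1) S(2) Suc.prems that]
    by (simp add: p_def scaleR_conv_of_real algebra_simps)
  have du: "(u has_vector_derivative (w - w0) * (\<Sum>j\<in>UNIV. M (p t) i j * D n j (p t))) (at t)"
    if "0 \<le> t" "t \<le> 1" for t
  proof -
    have "(p has_vector_derivative (w - w0)) (at t)"
      unfolding p_def by (auto intro!: derivative_eq_intros)
    from field_vector_diff_chain_at[OF this der[OF pS[OF that], of n i]]
    show ?thesis by (simp add: u_def o_def)
  qed
  have d\<phi>: "(\<phi> has_vector_derivative C * (K * d) ^ Suc n / fact n * t ^ n) (at t)" for t
  proof -
    have "(\<phi> has_field_derivative C * (K * d) ^ Suc n / fact (Suc n) * (of_nat (Suc n) * t ^ n)) (at t)"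
      unfolding \<phi>_def by (auto intro!: derivative_eq_intros simp del: of_nat_Suc power_Suc fact_Suc)
    moreover have "C * (K * d) ^ Suc n / fact (Suc n) * (of_nat (Suc n) * t ^ n) = C * (K * d) ^ Suc n / fact n * t ^ n"
      by (simp only: fact_Suc) (simp del: power_Suc of_nat_Suc)
    ultimately show ?thesis
      by (simp only: has_real_derivative_iff_has_vector_derivative)
  qed
  have bd: "norm ((w - w0) * (\<Sum>j\<in>UNIV. M (p t) i j * D n j (p t)))
      \<le> C * (K * d) ^ Suc n / fact n * t ^ n" if "0 \<le> t" "t \<le> 1" for t
  proof -
    let ?B = "C * (K * (t * d)) ^ n / fact n"
    have "norm (p t - w0) = t * d"
      using that by (simp add: p_def d_def norm_mult)
    then have b: "norm (D n j (p t)) \<le> ?B" for j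
      using Suc.IH[OF pS[OF that], of j] by simp
    have "norm (\<Sum>j\<in>UNIV. M (p t) i j * D n j (p t)) \<le> (\<Sum>j\<in>UNIV. norm (M (p t) i j) * ?B)"
      by (rule sum_norm_le) (simp only: norm_mult, intro mult_left_mono b norm_ge_zero)
    also have "\<dots> = (\<Sum>j\<in>UNIV. norm (M (p t) i j)) * ?B"
      by (rule sum_distrib_right[symmetric])
    also have "\<dots> \<le> K * ?B"
      using M[OF pS[OF that], of i] that K C0 by (intro mult_right_mono) (auto simp: d_def)
    finally have "d * norm (\<Sum>j\<in>UNIV. M (p t) i j * D n j (p t)) \<le> d * (K * ?B)"
      by (rule mult_left_mono) (simp add: d_def)
    then show ?thesis
      by (simp only: norm_mult d_def power_mult_distrib power_Suc) (simp add: mult_ac)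
  qed
  have "norm (u 1 - u 0) \<le> \<phi> 1 - \<phi> 0"
  proof (rule differentiable_bound_general[OF zero_less_one _ _ du d\<phi> bd])
    show "continuous_on {0..1} u"
      by (rule continuous_at_imp_continuous_on) (auto intro!: has_vector_derivative_continuous du)
    show "continuous_on {0..1} \<phi>"
      by (auto simp: \<phi>_def intro!: continuous_intros)
  qed auto
  then show ?case
    using zero by (simp add: u_def p_def \<phi>_def d_def)
qed

text \<open>The difference of two solutions with equal initial values is reproduced by the Picard
  step, so it satisfies the factorial bound for every \<open>n\<close> and is zero.\<close>

lemma linear_ode_unique:
  fixes Y Z :: "'n::finite \<Rightarrow> complex \<Rightarrow> complex" and M :: "complex \<Rightarrow> 'n \<Rightarrow> 'n \<Rightarrow> complex"
  assumes U: "convex U" "w0 \<in> U" "w \<in> U"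
    and M: "\<And>i j. (\<lambda>w. M w i j) holomorphic_on U"
    and Y: "\<And>w i. w \<in> U \<Longrightarrow> (Y i has_field_derivative (\<Sum>j\<in>UNIV. M w i j * Y j w)) (at w)"
    and Z: "\<And>w i. w \<in> U \<Longrightarrow> (Z i has_field_derivative (\<Sum>j\<in>UNIV. M w i j * Z j w)) (at w)"
    and init: "\<And>i. Y i w0 = Z i w0"
  shows "Y i w = Z i w"
proof -
  \<comment> \<open>On the compact segment both the coefficients and the difference are bounded,
    which supplies \<open>K\<close> and \<open>C\<close>.\<close>
  define S where "S = closed_segment w0 w"
  have S: "convex S" "compact S" "w0 \<in> S" "w \<in> S" "S \<subseteq> U"
    using U closed_segment_subset by (auto simp: S_def)
  define D where "D = (\<lambda>i w. Y i w - Z i w)"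
  have dD: "(D i has_field_derivative (\<Sum>j\<in>UNIV. M w i j * D j w)) (at w)" if "w \<in> U" for w i
    unfolding D_def using DERIV_diff[OF Y[OF that, of i] Z[OF that, of i]]
    by (simp add: right_diff_distrib sum_subtractf)
  have cM: "continuous_on S (\<lambda>w. \<Sum>i\<in>UNIV. \<Sum>j\<in>UNIV. norm (M w i j))"
    using M S(5) by (intro continuous_intros) (meson holomorphic_on_imp_continuous_on continuous_on_subset)
  have cD: "continuous_on S (\<lambda>w. \<Sum>i\<in>UNIV. norm (D i w))"
    using dD S(5) by (intro continuous_intros continuous_at_imp_continuous_on) (meson DERIV_isCont subsetD)
  obtain K where K: "\<And>w. w \<in> S \<Longrightarrow> (\<Sum>i\<in>UNIV. \<Sum>j\<in>UNIV. norm (M w i j)) \<le> K"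
    using compact_continuous_image[OF cM S(2)] unfolding compact_eq_bounded_closed bounded_iff
    by (auto simp: abs_le_iff)
  obtain C where C: "\<And>w. w \<in> S \<Longrightarrow> (\<Sum>i\<in>UNIV. norm (D i w)) \<le> C"
    using compact_continuous_image[OF cD S(2)] unfolding compact_eq_bounded_closed bounded_iff
    by (auto simp: abs_le_iff)
  have "norm (D i w) \<le> C * (K * norm (w - w0)) ^ n / fact n" for n
  proof (rule linear_ode_iterates_bound[where D = "\<lambda>n. D" and S = S and M = M])
    fix v i assume v: "v \<in> S"
    have "(\<Sum>j\<in>UNIV. norm (M v i j)) \<le> (\<Sum>i\<in>UNIV. \<Sum>j\<in>UNIV. norm (M v i j))"
      by (rule member_le_sum) (auto intro: sum_nonneg)
    then show "(\<Sum>j\<in>UNIV. norm (M v i j)) \<le> K" using K[OF v] by linarith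
    have "norm (D i v) \<le> (\<Sum>i\<in>UNIV. norm (D i v))"
      by (rule member_le_sum) auto
    then show "norm (D i v) \<le> C" using C[OF v] by linarith
  qed (use S dD init in \<open>auto simp: D_def\<close>)
  moreover have "(\<lambda>n. C * ((K * norm (w - w0)) ^ n / fact n)) \<longlonglongrightarrow> C * 0"
    using summable_exp[of "K * norm (w - w0)"]
    by (intro tendsto_intros summable_LIMSEQ_zero) (simp add: field_simps)
  ultimately have "norm (D i w) \<le> 0"
    using LIMSEQ_le_const[of _ "C * 0" "norm (D i w)"] by force
  then show ?thesis by (simp add: D_def)
qed

text \<open>Picard iteration with complex primitives in place of integrals. Convexity of the domain
  makes the primitives global, and the factorial bound makes the iterates converge uniformly on
  compact convex sets around \<open>w0\<close>, so the solution lives on all of \<open>U\<close> and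
  not just near \<open>w0\<close>.\<close>

lemma linear_ode_exists:
  fixes v :: "'n::finite \<Rightarrow> complex" and M :: "complex \<Rightarrow> 'n \<Rightarrow> 'n \<Rightarrow> complex"
  assumes U: "convex U" "open U" "w0 \<in> U"
    and M: "\<And>i j. (\<lambda>w. M w i j) holomorphic_on U"
  shows "\<exists>Y :: 'n \<Rightarrow> complex \<Rightarrow> complex. (\<forall>i. Y i w0 = v i) \<and>
    (\<forall>w\<in>U. \<forall>i. (Y i has_field_derivative (\<Sum>j\<in>UNIV. M w i j * Y j w)) (at w))"
proof -
  \<comment> \<open>A primitive that vanishes at \<open>w0\<close>, chosen once for each integrand;
    it is meaningful only for holomorphic \<open>f\<close>, hence the induction \<open>Yhol\<close>
    before its derivative is used.\<close>
  define prim where "prim = (\<lambda>f. SOME g. g w0 = (0::complex) \<and> (\<forall>w\<in>U. (g has_field_derivative f w) (at w)))"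
  have prim: "prim f w0 = 0 \<and> (\<forall>w\<in>U. (prim f has_field_derivative f w) (at w))"
    if hol: "f holomorphic_on U" for f
  proof -
    obtain g where "g w0 = 0" "\<And>w. w \<in> U \<Longrightarrow> (g has_field_derivative f w) (at w)"
      using primitive_vanishing_at[OF U(1,2) hol] by blast
    then have "\<exists>g. g w0 = 0 \<and> (\<forall>w\<in>U. (g has_field_derivative f w) (at w))"
      by blast
    then show ?thesis unfolding prim_def by (rule someI_ex)
  qed
  define step where "step = (\<lambda>Y i w. v i + prim (\<lambda>w. \<Sum>j\<in>UNIV. M w i j * Y j w) w)"
  define Y where "Y = (\<lambda>n. (step ^^ n) (\<lambda>i w. v i))"
  have YS: "Y (Suc n) = step (Y n)" for n by (simp add: Y_def)
  have Yhol: "Y n i holomorphic_on U" for n i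
  proof (induction n arbitrary: i)
    case 0
    then show ?case by (simp add: Y_def)
  next
    case (Suc n)
    have "(\<lambda>w. \<Sum>j\<in>UNIV. M w i j * Y n j w) holomorphic_on U"
      by (intro holomorphic_intros M Suc.IH)
    from prim[OF this] have "prim (\<lambda>w. \<Sum>j\<in>UNIV. M w i j * Y n j w) holomorphic_on U"
      by (meson holomorphic_onI field_differentiable_at_within field_differentiable_def)
    then show ?case
      unfolding YS step_def by (intro holomorphic_intros)
  qed
  have Yder: "(Y (Suc n) i has_field_derivative (\<Sum>j\<in>UNIV. M w i j * Y n j w)) (at w)" if "w \<in> U" for n i w
  proof -
    have "(\<lambda>w. \<Sum>j\<in>UNIV. M w i j * Y n j w) holomorphic_on U"
      by (intro holomorphic_intros M Yhol)
    with prim that show ?thesis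
      unfolding YS step_def by (auto intro!: derivative_eq_intros)
  qed
  have Y0: "Y n i w0 = v i" for n i
  proof (cases n)
    case (Suc m)
    have "(\<lambda>w. \<Sum>j\<in>UNIV. M w i j * Y m j w) holomorphic_on U"
      by (intro holomorphic_intros M Yhol)
    with prim Suc show ?thesis unfolding Suc YS step_def by auto
  qed (simp add: Y_def)
  define D where "D = (\<lambda>n i w. Y (Suc n) i w - Y n i w)"
  have Dder: "(D (Suc n) i has_field_derivative (\<Sum>j\<in>UNIV. M w i j * D n j w)) (at w)" if "w \<in> U" for n i w
    unfolding D_def using DERIV_diff[OF Yder[OF that, of "Suc n" i] Yder[OF that, of n i]]
    by (simp add: right_diff_distrib sum_subtractf)
  have Ysum: "Y n i w = v i + (\<Sum>k<n. D k i w)" for n i w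
    by (induction n) (auto simp: D_def Y_def)
  define Z where "Z = (\<lambda>i w. v i + (\<Sum>k. D k i w))"
  have ulim: "uniform_limit S (\<lambda>n. Y n i) (Z i) sequentially"
    if S: "convex S" "compact S" "w0 \<in> S" "S \<subseteq> U" for S i
  proof -
    have cM: "continuous_on S (\<lambda>w. \<Sum>i\<in>UNIV. \<Sum>j\<in>UNIV. norm (M w i j))"
      using M S(4) by (intro continuous_intros) (meson holomorphic_on_imp_continuous_on continuous_on_subset)
    have "\<And>i. D 0 i holomorphic_on U"
      unfolding D_def by (intro holomorphic_intros Yhol)
    then have cD: "continuous_on S (\<lambda>w. \<Sum>i\<in>UNIV. norm (D 0 i w))"
      using S(4) by (intro continuous_intros) (meson holomorphic_on_imp_continuous_on continuous_on_subset)
    obtain K where K: "\<And>w. w \<in> S \<Longrightarrow> (\<Sum>i\<in>UNIV. \<Sum>j\<in>UNIV. norm (M w i j)) \<le> K"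
      using compact_continuous_image[OF cM S(2)] unfolding compact_eq_bounded_closed bounded_iff
      by (auto simp: abs_le_iff)
    obtain C where C: "\<And>w. w \<in> S \<Longrightarrow> (\<Sum>i\<in>UNIV. norm (D 0 i w)) \<le> C"
      using compact_continuous_image[OF cD S(2)] unfolding compact_eq_bounded_closed bounded_iff
      by (auto simp: abs_le_iff)
    obtain L where L: "\<And>w. w \<in> S \<Longrightarrow> norm w \<le> L"
      using compact_imp_bounded[OF S(2)] unfolding bounded_iff by blast
    have K0: "K \<ge> 0"
      using K[OF S(3)] by (meson order_trans sum_nonneg norm_ge_zero)
    have C0: "C \<ge> 0"
      using C[OF S(3)] by (meson order_trans sum_nonneg norm_ge_zero)
    have bound: "norm (D n i w) \<le> C * ((K * (2 * L)) ^ n / fact n)" if "w \<in> S" for n w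
    proof -
      have "norm (D n i w) \<le> C * (K * norm (w - w0)) ^ n / fact n"
      proof (rule linear_ode_iterates_bound[where S = S and M = M])
        fix v i assume v: "v \<in> S"
        have "(\<Sum>j\<in>UNIV. norm (M v i j)) \<le> (\<Sum>i\<in>UNIV. \<Sum>j\<in>UNIV. norm (M v i j))"
          by (rule member_le_sum) (auto intro: sum_nonneg)
        then show "(\<Sum>j\<in>UNIV. norm (M v i j)) \<le> K" using K[OF v] by linarith
        have "norm (D 0 i v) \<le> (\<Sum>i\<in>UNIV. norm (D 0 i v))"
          by (rule member_le_sum) auto
        then show "norm (D 0 i v) \<le> C" using C[OF v] by linarith
      next
        show "D (Suc n) i w0 = 0" for n i unfolding D_def by (simp add: Y0)
      qed (use S Dder that in auto)
      also have "\<dots> \<le> C * (K * (2 * L)) ^ n / fact n"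
      proof -
        \<comment> \<open>Replaces the distance by a bound uniform in \<open>w\<close>, as the
          M-test requires.\<close>
        have "norm (w - w0) \<le> 2 * L"
          using L[OF that] L[OF S(3)] norm_triangle_ineq4[of w w0] by linarith
        then show ?thesis
          using K0 C0 by (intro divide_right_mono mult_left_mono power_mono) auto
      qed
      finally show ?thesis by simp
    qed
    have "summable (\<lambda>n. C * ((K * (2 * L)) ^ n / fact n))"
      using summable_exp[of "K * (2 * L)"] by (intro summable_mult) (simp add: field_simps)
    from Weierstrass_m_test[OF bound this]
    have "uniform_limit S (\<lambda>n w. \<Sum>k<n. D k i w) (\<lambda>w. \<Sum>k. D k i w) sequentially" .
    then have "uniform_limit S (\<lambda>n w. v i + (\<Sum>k<n. D k i w)) (Z i) sequentially"
      unfolding Z_def by (intro uniform_limit_intros)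
    then show ?thesis unfolding Ysum .
  qed
  \<comment> \<open>Locally uniform limits may be differentiated. The shifted sequence is used
    because the derivative of \<open>Y (Suc n)\<close> is expressed by \<open>Y n\<close>, whose
    limit is known.\<close>
  have "\<exists>g'. \<forall>w\<in>U. (Z i has_field_derivative g' w) (at w) \<and>
      (\<lambda>n. \<Sum>j\<in>UNIV. M w i j * Y n j w) \<longlonglongrightarrow> g' w" for i
  proof (rule has_complex_derivative_uniform_sequence[where f = "\<lambda>n. Y (Suc n) i"])
    fix x assume "x \<in> U"
    then obtain d where d: "d > 0" "cball x d \<subseteq> U"
      using U(2) open_contains_cball by blast
    \<comment> \<open>The estimate runs along segments from \<open>w0\<close>, so the disc about
      \<open>x\<close> is enlarged to a compact convex subset of \<open>U\<close> that contains
      \<open>w0\<close>.\<close>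
    define S where "S = convex hull (insert w0 (cball x d))"
    have "S \<subseteq> U" unfolding S_def using U d by (intro hull_minimal) auto
    moreover have "compact S" unfolding S_def by (intro compact_convex_hull compact_insert) simp
    moreover have "w0 \<in> S" "cball x d \<subseteq> S"
      unfolding S_def by (auto intro: hull_inc)
    ultimately have "uniform_limit (cball x d) (\<lambda>n. Y n i) (Z i) sequentially"
      using ulim[of S i] uniform_limit_on_subset S_def convex_convex_hull by blast
    then have "uniform_limit (cball x d) (\<lambda>n. Y (Suc n) i) (Z i) sequentially"
      by (rule filterlim_compose[OF _ filterlim_Suc])
    with d show "\<exists>d>0. cball x d \<subseteq> U \<and> uniform_limit (cball x d) (\<lambda>n. Y (Suc n) i) (Z i) sequentially"
      by blast
  qed (use U Yder in auto)
  then have "\<forall>i. \<exists>g'. \<forall>w\<in>U. (Z i has_field_derivative g' w) (at w) \<and>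
      (\<lambda>n. \<Sum>j\<in>UNIV. M w i j * Y n j w) \<longlonglongrightarrow> g' w" by (rule allI)
  from choice[OF this]
  obtain g' where g': "\<And>i w. w \<in> U \<Longrightarrow> (Z i has_field_derivative g' i w) (at w)"
      "\<And>i w. w \<in> U \<Longrightarrow> (\<lambda>n. \<Sum>j\<in>UNIV. M w i j * Y n j w) \<longlonglongrightarrow> g' i w"
    by blast
  have lim: "(\<lambda>n. Y n i w) \<longlonglongrightarrow> Z i w" if "w \<in> U" for i w
  proof -
    have "closed_segment w0 w \<subseteq> U" using U that closed_segment_subset by blast
    from tendsto_uniform_limitI[OF ulim[OF _ _ _ this, of i]] show ?thesis by auto
  qed
  have "(Z i has_field_derivative (\<Sum>j\<in>UNIV. M w i j * Z j w)) (at w)" if "w \<in> U" for i w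
  proof -
    have "(\<lambda>n. \<Sum>j\<in>UNIV. M w i j * Y n j w) \<longlonglongrightarrow> (\<Sum>j\<in>UNIV. M w i j * Z j w)"
      by (intro tendsto_intros lim that)
    from LIMSEQ_unique[OF this g'(2)[OF that]] g'(1)[OF that, of i] show ?thesis by simp
  qed
  moreover have "Z i w0 = v i" for i
    using lim[OF U(3), of i] by (simp add: Y0 LIMSEQ_const_iff)
  ultimately show ?thesis by blast
qed

section \<open>Cuts and loops\<close>

lemma exp_cut_log:
  assumes "x \<noteq> 0"
  shows "exp (cut_log \<eta> x) = x"
proof -
  have "exp (cut_log \<eta> x) = x * (cis (pi - \<eta>) * cis (\<eta> - pi))"
    using assms by (simp add: cut_log_def exp_add cis_conv_exp)
  then show ?thesis by (simp add: cis_mult)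
qed

lemma cut_log_exp:
  assumes "\<eta> - 2 * pi < Im w" "Im w < \<eta>"
  shows "cut_log \<eta> (exp w) = w"
proof -
  have "exp w * cis (pi - \<eta>) = exp (w + \<i> * of_real (pi - \<eta>))"
    by (simp add: exp_add cis_conv_exp)
  moreover have "Ln (exp (w + \<i> * of_real (pi - \<eta>))) = w + \<i> * of_real (pi - \<eta>)"
    using assms by (intro Ln_exp) auto
  ultimately show ?thesis
    by (simp add: cut_log_def algebra_simps)
qed

text \<open>Multiplication by \<open>cis (- \<eta>)\<close> turns the common direction of the cuts
  into that of the positive real axis.\<close>

lemma mem_cut_iff:
  "z \<in> cut lam \<eta> k \<longleftrightarrow> Im ((z - lam k) * cis (- \<eta>)) = 0 \<and> 0 \<le> Re ((z - lam k) * cis (- \<eta>))"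
proof
  assume "z \<in> cut lam \<eta> k"
  then obtain t where "t \<ge> 0" "z = lam k + of_real t * cis \<eta>"
    by (auto simp: cut_def)
  moreover from this have "(z - lam k) * cis (- \<eta>) = of_real t"
    by (simp add: mult.assoc cis_mult)
  ultimately show "Im ((z - lam k) * cis (- \<eta>)) = 0 \<and> 0 \<le> Re ((z - lam k) * cis (- \<eta>))"
    by (simp only: Re_complex_of_real Im_complex_of_real)
next
  assume *: "Im ((z - lam k) * cis (- \<eta>)) = 0 \<and> 0 \<le> Re ((z - lam k) * cis (- \<eta>))"
  define t where "t = Re ((z - lam k) * cis (- \<eta>))"
  have "(z - lam k) * cis (- \<eta>) = of_real t"
    using * by (simp add: t_def complex_eq_iff)
  then have "(z - lam k) * (cis (- \<eta>) * cis \<eta>) = of_real t * cis \<eta>"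
    by (simp add: mult.assoc[symmetric])
  then have "z - lam k = of_real t * cis \<eta>"
    by (simp add: cis_mult)
  then have "z = lam k + of_real t * cis \<eta>" by (simp add: algebra_simps)
  moreover have "t \<ge> 0" using * by (simp add: t_def)
  ultimately show "z \<in> cut lam \<eta> k" unfolding cut_def by blast
qed

section \<open>Topology of the cut plane\<close>

lemma open_cut_plane: "open (cut_plane (lam :: 'n::finite \<Rightarrow> complex) \<eta>)"
proof -
  have "closed (cut lam \<eta> k)" for k
  proof -
    have "cut lam \<eta> k = {z. Im ((z - lam k) * cis (- \<eta>)) = 0} \<inter> {z. 0 \<le> Re ((z - lam k) * cis (- \<eta>))}"
      by (auto simp: mem_cut_iff)
    then show ?thesis
      by (simp only:) (intro closed_Int closed_Collect_eq closed_Collect_le continuous_intros)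
  qed
  then show ?thesis
    unfolding cut_plane_def by (intro open_Compl closed_UN) auto
qed

text \<open>A point off the cuts can be moved backwards, against the direction of the cuts, without
  ever meeting one. It ends up in a half-plane behind all the poles, which is convex and free of
  cuts, so all points are joined there.\<close>

lemma connected_cut_plane: "connected (cut_plane (lam :: 'n::finite \<Rightarrow> complex) \<eta>)"
proof -
  define m where "m = Min (range (\<lambda>k. Re (lam k * cis (- \<eta>))))"
  define H where "H = {z. Re (z * cis (- \<eta>)) < m}"
  define ray where "ray = (\<lambda>z. (\<lambda>t. z - of_real t * cis \<eta>) ` {0::real..})"
  have m: "m \<le> Re (lam k * cis (- \<eta>))" for k
    unfolding m_def by (rule Min_le) auto
  have "convex H"
  proof -
    have "H = {z. inner (cis \<eta>) z < m}"
      by (simp add: H_def inner_complex_def algebra_simps)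
    then show ?thesis by (simp only: convex_halfspace_lt)
  qed
  then have H: "connected H" by (rule convex_connected)
  have sub_H: "H \<subseteq> cut_plane lam \<eta>"
  proof
    fix z assume z: "z \<in> H"
    have "z \<notin> cut lam \<eta> k" for k
      using z m[of k] by (auto simp: H_def mem_cut_iff left_diff_distrib)
    then show "z \<in> cut_plane lam \<eta>" by (simp add: cut_plane_def)
  qed
  have shift: "(z - of_real t * cis \<eta>) * cis (- \<eta>) = z * cis (- \<eta>) - of_real t" for z t
    by (simp add: left_diff_distrib mult.assoc cis_mult)
  have sub_ray: "ray z \<subseteq> cut_plane lam \<eta>" if z: "z \<in> cut_plane lam \<eta>" for z
  proof -
    have "z - of_real t * cis \<eta> \<notin> cut lam \<eta> k" if "t \<ge> 0" for t k
    proof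
      assume "z - of_real t * cis \<eta> \<in> cut lam \<eta> k"
      with that have "z \<in> cut lam \<eta> k"
        unfolding mem_cut_iff left_diff_distrib[of _ "lam k"] shift by simp
      with z show False by (auto simp: cut_plane_def)
    qed
    then show ?thesis by (auto simp: ray_def cut_plane_def)
  qed
  have ray_meets: "ray z \<inter> H \<noteq> {}" for z
  proof -
    define t where "t = \<bar>Re (z * cis (- \<eta>)) - m\<bar> + 1"
    have "z - of_real t * cis \<eta> \<in> H"
      unfolding H_def mem_Collect_eq shift by (simp add: t_def del: times_complex.sel)
    moreover have "z - of_real t * cis \<eta> \<in> ray z"
      unfolding ray_def t_def by (rule imageI) simp
    ultimately show ?thesis by blast
  qed
  have "connected (\<Union>z\<in>cut_plane lam \<eta>. ray z \<union> H)"
  proof (rule connected_Union)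
    fix S assume "S \<in> (\<lambda>z. ray z \<union> H) ` cut_plane lam \<eta>"
    then obtain z where S: "S = ray z \<union> H" by blast
    have "connected (ray z)"
      unfolding ray_def by (intro connected_continuous_image continuous_intros) auto
    then show "connected S"
      unfolding S using H ray_meets by (intro connected_Un)
  next
    have "H \<noteq> {}" using ray_meets by blast
    then show "\<Inter> ((\<lambda>z. ray z \<union> H) ` cut_plane lam \<eta>) \<noteq> {}" by blast
  qed
  also have "(\<Union>z\<in>cut_plane lam \<eta>. ray z \<union> H) = cut_plane lam \<eta>"
  proof
    have "z \<in> ray z" for z unfolding ray_def by (rule image_eqI[of _ _ 0]) auto
    then show "cut_plane lam \<eta> \<subseteq> (\<Union>z\<in>cut_plane lam \<eta>. ray z \<union> H)" by blast
  qed (use sub_ray sub_H in blast)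
  finally show ?thesis .
qed

text \<open>With \<open>R\<close> the logarithm of a radius, this is the image under
  \<open>cut_log\<close> of the disc about a pole with its cut removed. The half-plane
  \<open>Re w < R\<close> around it plays the role of the universal covering of the punctured disc,
  with translation by 2 pi i as the deck transformation.\<close>

definition strip :: "real \<Rightarrow> real \<Rightarrow> complex set" where
  "strip \<eta> R = {w. Re w < R \<and> \<eta> - 2 * pi < Im w \<and> Im w < \<eta>}"

lemma open_strip: "open (strip \<eta> R)"
proof -
  have "strip \<eta> R = {w. Re w < R} \<inter> {w. \<eta> - 2 * pi < Im w} \<inter> {w. Im w < \<eta>}"
    by (auto simp: strip_def)
  then show ?thesis
    by (simp add: open_Int open_halfspace_Re_lt open_halfspace_Im_lt open_halfspace_Im_gt)
qed

lemma convex_strip: "convex (strip \<eta> R)"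
proof -
  have "strip \<eta> R = {w. Re w < R} \<inter> {w. \<eta> - 2 * pi < Im w} \<inter> {w. Im w < \<eta>}"
    by (auto simp: strip_def)
  then show ?thesis
    by (simp add: convex_Int convex_halfspace_Re_lt convex_halfspace_Im_lt convex_halfspace_Im_gt)
qed

lemma strip_nonempty: "strip \<eta> R \<noteq> {}"
proof -
  have "Complex (R - 1) (\<eta> - pi) \<in> strip \<eta> R" by (simp add: strip_def)
  then show ?thesis by blast
qed

text \<open>On the cut every logarithm has imaginary part \<eta> modulo 2 pi, and the strip lies
  strictly between two consecutive values of this kind.\<close>

lemma exp_strip_notin_cut:
  assumes "w \<in> strip \<eta> R"
  shows "lam k + exp w \<notin> cut lam \<eta> k"
proof
  assume "lam k + exp w \<in> cut lam \<eta> k"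
  then obtain t where t: "t \<ge> 0" "exp w = of_real t * cis \<eta>"
    by (auto simp: cut_def)
  then have "t > 0" by (cases "t = 0") auto
  then have "exp w = exp (Complex (ln t) \<eta>)"
    using t by (simp add: exp_eq_polar)
  then obtain n :: int where "Im w = \<eta> + 2 * pi * n"
    unfolding exp_eq by (auto simp: complex_eq_iff)
  with assms have "2 * pi * (-1) < 2 * pi * real_of_int n" "2 * pi * real_of_int n < 2 * pi * 0"
    by (auto simp: strip_def)
  then have "-1 < real_of_int n" "real_of_int n < 0"
    by (simp_all only: mult_less_cancel_left_pos[OF mult_pos_pos[OF zero_less_numeral pi_gt_zero]])
  then have "of_int (- 1) < real_of_int n" "real_of_int n < of_int 0"
    by simp_all
  then show False unfolding of_int_less_iff by simp
qed

lemma exp_strip_mem_cut_plane: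
  assumes "w \<in> strip \<eta> (ln r)" "r > 0"
    and "\<And>k. k \<noteq> j \<Longrightarrow> ball (lam j) r \<inter> cut lam \<eta> k = {}"
  shows "lam j + exp w \<in> cut_plane lam \<eta> \<inter> ball (lam j) r"
proof -
  have "norm (exp w) < exp (ln r)"
    using assms(1) by (simp add: strip_def)
  then have ball: "lam j + exp w \<in> ball (lam j) r"
    using assms(2) by (simp add: dist_norm)
  have "lam j + exp w \<notin> cut lam \<eta> k" for k
  proof (cases "k = j")
    case True
    then show ?thesis using exp_strip_notin_cut[OF assms(1), of lam j] by simp
  next
    case False
    from assms(3)[OF this] ball show ?thesis by auto
  qed
  with ball show ?thesis by (simp add: cut_plane_def)
qed

lemma cut_log_mem_strip:
  assumes "z \<in> cut_plane lam \<eta>" "norm (z - lam k) < r"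
  shows "cut_log \<eta> (z - lam k) \<in> strip \<eta> (ln r)" "exp (cut_log \<eta> (z - lam k)) = z - lam k"
proof -
  let ?x = "z - lam k" and ?w = "cut_log \<eta> (z - lam k)"
  have notin: "z \<notin> cut lam \<eta> k" using assms(1) by (simp add: cut_plane_def)
  have "?x \<noteq> 0"
    using notin by (auto simp: mem_cut_iff)
  then show e: "exp ?w = ?x" by (rule exp_cut_log)
  have "?x * cis (pi - \<eta>) \<noteq> 0" using \<open>?x \<noteq> 0\<close> by simp
  then have "-pi < Im (Ln (?x * cis (pi - \<eta>)))" "Im (Ln (?x * cis (pi - \<eta>))) \<le> pi"
    using mpi_less_Im_Ln Im_Ln_le_pi by blast+
  then have "\<eta> - 2 * pi < Im ?w" "Im ?w \<le> \<eta>"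
    by (simp_all add: cut_log_def)
  \<comment> \<open>The principal logarithm gives only a weak inequality at the upper end; equality
    there means that \<open>z\<close> lies on the cut.\<close>
  moreover have "Im ?w \<noteq> \<eta>"
  proof
    assume "Im ?w = \<eta>"
    then have "?x = of_real (exp (Re ?w)) * cis \<eta>"
      using exp_eq_polar[of ?w] e by simp
    then have "z = lam k + of_real (exp (Re ?w)) * cis \<eta>" by (simp add: algebra_simps)
    then have "z \<in> cut lam \<eta> k"
      unfolding cut_def by (intro CollectI exI[of _ "exp (Re ?w)"]) simp
    with notin show False ..
  qed
  moreover have "Re ?w < ln r"
  proof -
    have "exp (Re ?w) < r" using assms(2) e norm_exp_eq_Re[of ?w] by simp
    moreover from this have "r > 0" using exp_gt_zero[of "Re ?w"] by linarith
    ultimately show ?thesis by (metis ln_exp ln_less_cancel_iff exp_gt_zero)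
  qed
  ultimately show "?w \<in> strip \<eta> (ln r)"
    by (simp add: strip_def)
qed

lemma has_field_derivative_cut_log:
  assumes "z \<in> cut_plane lam \<eta>"
  shows "((\<lambda>z. cut_log \<eta> (z - lam k)) has_field_derivative 1 / (z - lam k)) (at z)"
proof -
  let ?x = "z - lam k"
  have notin: "z \<notin> cut lam \<eta> k" using assms(1) by (simp add: cut_plane_def)
  then have x0: "?x \<noteq> 0" by (auto simp: mem_cut_iff)
  have "?x * cis (pi - \<eta>) \<notin> \<real>\<^sub>\<le>\<^sub>0"
  proof
    assume "?x * cis (pi - \<eta>) \<in> \<real>\<^sub>\<le>\<^sub>0"
    moreover have "cis (pi - \<eta>) = - cis (- \<eta>)"
      by (simp add: complex_eq_iff)
    ultimately have "z \<in> cut lam \<eta> k"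
      by (simp add: mem_cut_iff complex_nonpos_Reals_iff)
    with notin show False ..
  qed
  then show ?thesis
    unfolding cut_log_def using x0
    by (auto intro!: derivative_eq_intros simp: mult.assoc cis_mult inverse_eq_divide)
qed

text \<open>Admissibility in geometric form: if the ray going backwards from a pole met the cut of
  another pole, the difference of the two poles would have argument \<eta>. Thus the cut plane
  contains points at every positive distance from a pole, in a fixed direction.\<close>

lemma admissible_backward_mem_cut_plane:
  assumes "inj lam" "admissible lam \<eta>" "t > 0"
  shows "lam m - of_real t * cis \<eta> \<in> cut_plane lam \<eta>"
proof -
  have "lam m - of_real t * cis \<eta> \<notin> cut lam \<eta> i" for i
  proof
    assume "lam m - of_real t * cis \<eta> \<in> cut lam \<eta> i"
    then obtain s where s: "s \<ge> 0" "lam m - of_real t * cis \<eta> = lam i + of_real s * cis \<eta>"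
      by (auto simp: cut_def)
    then have eq: "lam m - lam i = of_real (s + t) * cis \<eta>"
      by (simp add: algebra_simps)
    have st: "s + t > 0" using s assms by simp
    have "of_real (s + t) * cis \<eta> \<noteq> 0"
      using st by (simp only: mult_eq_0_iff of_real_eq_0_iff cis_neq_zero) simp
    then have "lam m \<noteq> lam i" using eq by auto
    then have mi: "m \<noteq> i" by blast
    have "cis (Arg (lam m - lam i)) = sgn (lam m - lam i)"
      using \<open>lam m \<noteq> lam i\<close> by (intro cis_Arg) simp
    also have "\<dots> = cis \<eta>"
      using st unfolding eq by (simp only: sgn_mult sgn_of_real) simp
    finally have "exp (\<i> * of_real \<eta>) = exp (\<i> * of_real (Arg (lam m - lam i)))"
      by (simp add: cis_conv_exp)
    then obtain n :: int where "\<i> * of_real \<eta> = \<i> * of_real (Arg (lam m - lam i)) + (of_int (2 * n) * pi) * \<i>"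
      unfolding exp_eq by auto
    then have "\<eta> = Arg (lam m - lam i) + 2 * pi * of_int n"
      by (simp add: complex_eq_iff)
    with mi assms(2) show False unfolding admissible_def by blast
  qed
  then show ?thesis by (simp add: cut_plane_def)
qed

text \<open>Winding number 1 means that a continuous logarithm of the loop ends 2 pi i above its
  start. Composing \<open>\<Phi>\<close> with local branches of the logarithm along this path gives
  the function elements of the continuation; at the start they represent \<open>f\<close>, and at
  the end, where the branch has grown by 2 pi i, they represent \<open>g\<close>.\<close>

lemma loop_transform_lift:
  fixes lam :: "'n::finite \<Rightarrow> complex" and f g :: "complex \<Rightarrow> complex^'n"
  assumes path: "path \<gamma>" "pathfinish \<gamma> = pathstart \<gamma>" "pathstart \<gamma> \<in> cut_plane lam \<eta>"
    and \<gamma>: "path_image \<gamma> \<subseteq> ball (lam j) r - {lam j}" "winding_number \<gamma> (lam j) = 1"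
    and g: "g vholomorphic_on cut_plane lam \<eta>"
    and \<Phi>: "\<And>i. \<Phi> i holomorphic_on {w. Re w < ln r}"
    and \<Phi>f: "\<And>i w. w \<in> strip \<eta> (ln r) \<Longrightarrow> \<Phi> i w = f (lam j + exp w) $ i"
    and \<Phi>g: "\<And>i w. w \<in> strip \<eta> (ln r) \<Longrightarrow> \<Phi> i (w + 2 * of_real pi * \<i>) = g (lam j + exp w) $ i"
  shows "loop_transform (cut_plane lam \<eta>) \<gamma> f g"
proof -
  let ?P = "cut_plane lam \<eta>"
  obtain q0 where q0: "path q0"
      "pathfinish q0 - pathstart q0 = 2 * of_real pi * \<i> * winding_number \<gamma> (lam j)"
      "\<And>t. t \<in> {0..1} \<Longrightarrow> \<gamma> t = lam j + exp (q0 t)"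
    using winding_number_as_continuous_log[OF path(1), of "lam j"] \<gamma>(1) by auto
  have \<gamma>0: "\<gamma> 0 \<in> ?P" using path(3) by (simp add: pathstart_def)
  have in_img: "\<gamma> t \<in> path_image \<gamma>" if "t \<in> {0..1}" for t
    using that by (simp add: path_image_def)
  have near: "norm (\<gamma> 0 - lam j) < r"
    using in_img[of 0] \<gamma>(1) by (auto simp: dist_norm norm_minus_commute)
  define w0 where "w0 = cut_log \<eta> (\<gamma> 0 - lam j)"
  have w0: "w0 \<in> strip \<eta> (ln r)" "exp w0 = \<gamma> 0 - lam j"
    unfolding w0_def using cut_log_mem_strip[OF \<gamma>0 near] by auto
  have e0: "exp (w0 - q0 0) = 1"
    using q0(3)[of 0] w0 by (simp add: exp_diff)
  \<comment> \<open>The logarithm is moved by a period so as to start at \<open>cut_log\<close> of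
    the base point, inside the strip, where \<open>\<Phi>\<close> is known to be the pull-back of
    \<open>f\<close>.\<close>
  define q where "q = (\<lambda>t. q0 t + (w0 - q0 0))"
  have qexp: "exp (q t) = \<gamma> t - lam j" if "t \<in> {0..1}" for t
    using q0(3)[OF that] e0 by (simp add: q_def exp_add)
  have q_0: "q 0 = w0" by (simp add: q_def)
  have q_1: "q 1 = w0 + 2 * of_real pi * \<i>"
    using q0(2) \<gamma>(2) by (simp add: q_def pathstart_def pathfinish_def algebra_simps)
  have qcont: "continuous_on {0..1} q"
    using q0(1) unfolding q_def path_def by (intro continuous_intros)
  have qU: "Re (q t) < ln r" if "t \<in> {0..1}" for t
  proof -
    have "\<gamma> t \<in> ball (lam j) r" using in_img[OF that] \<gamma>(1) by blast
    then have *: "norm (exp (q t)) < r" using qexp[OF that] by (simp add: dist_norm norm_minus_commute)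
    then have "r > 0" using norm_ge_zero[of "exp (q t)"] by linarith
    with * show ?thesis by (metis ln_exp ln_less_cancel_iff exp_gt_zero norm_exp_eq_Re)
  qed
  \<comment> \<open>The branch of the logarithm near \<open>\<gamma> t\<close> with value
    \<open>q t\<close> there: the argument of \<open>Ln\<close> is 1 at \<open>\<gamma> t\<close>,
    away from its discontinuity.\<close>
  define L where "L = (\<lambda>t z. q t + Ln ((z - lam j) / exp (q t)))"
  have L_self: "L t (\<gamma> t) = q t" if "t \<in> {0..1}" for t
    using qexp[OF that] by (simp add: L_def flip: qexp[OF that])
  have L_an: "L t analytic_on {\<gamma> t}" if "t \<in> {0..1}" for t
  proof -
    have "(\<lambda>z. (z - lam j) / exp (q t)) (\<gamma> t) = 1"
      using qexp[OF that] by (simp flip: qexp[OF that])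
    then show ?thesis
      unfolding L_def by (intro analytic_intros) auto
  qed
  have openU: "open {w. Re w < ln r}" by (rule open_halfspace_Re_lt)
  define G where "G = (\<lambda>t z. \<chi> i. \<Phi> i (L t z))"
  have G_an: "vanalytic_at (G t) (\<gamma> t)" if t: "t \<in> {0..1}" for t
  proof -
    have "(\<Phi> i \<circ> L t) analytic_on {\<gamma> t}" for i
    proof (rule analytic_on_compose[OF L_an[OF t]])
      have "\<Phi> i analytic_on {w. Re w < ln r}"
        using \<Phi>[of i] openU by (simp add: analytic_on_open)
      then show "\<Phi> i analytic_on L t ` {\<gamma> t}"
        by (rule analytic_on_subset) (simp add: L_self[OF t] qU[OF t])
    qed
    then show ?thesis by (simp add: vanalytic_at_def G_def o_def)
  qed
  have G_loc: "\<exists>\<delta>>0. \<forall>s\<in>{0..1}. \<bar>s - t\<bar> < \<delta> \<longrightarrow> (\<forall>\<^sub>F z in nhds (\<gamma> s). G s z = G t z)"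
    if t: "t \<in> {0..1}" for t
  proof -
    \<comment> \<open>The bound \<open>pi / 2\<close> for \<open>q s - q t\<close>, and the same
      bound for the local logarithm near \<open>\<gamma> s\<close>, keep the imaginary part of their
      sum below pi, so \<open>Ln\<close> returns the sum itself and neighbouring branches agree
      without a jump by a period.\<close>
    obtain \<delta> where \<delta>: "\<delta> > 0" "\<And>s. s \<in> {0..1} \<Longrightarrow> dist s t < \<delta> \<Longrightarrow> dist (q s) (q t) < pi / 2"
      using qcont t unfolding continuous_on_iff by (meson pi_half_gt_zero)
    have "\<forall>\<^sub>F z in nhds (\<gamma> s). G s z = G t z" if s: "s \<in> {0..1}" "\<bar>s - t\<bar> < \<delta>" for s
    proof -
      have "norm (q s - q t) < pi / 2"
        using \<delta>(2)[OF s(1)] s(2) by (simp add: dist_norm)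
      then have im: "\<bar>Im (q s - q t)\<bar> < pi / 2"
        using abs_Im_le_cmod order_le_less_trans by blast
      have "isCont (\<lambda>z. Ln ((z - lam j) / exp (q s))) (\<gamma> s)"
        using qexp[OF s(1)] by (intro continuous_intros) (auto simp flip: qexp[OF s(1)])
      moreover have "Ln ((\<gamma> s - lam j) / exp (q s)) = 0"
        by (simp flip: qexp[OF s(1)])
      ultimately have "(\<lambda>z. Ln ((z - lam j) / exp (q s))) \<midarrow>\<gamma> s\<rightarrow> 0"
        by (simp add: isCont_def)
      then have "\<forall>\<^sub>F z in at (\<gamma> s). dist (Ln ((z - lam j) / exp (q s))) 0 < pi / 2"
        using pi_half_gt_zero by (rule tendstoD)
      then have "\<forall>\<^sub>F z in nhds (\<gamma> s). dist (Ln ((z - lam j) / exp (q s))) 0 < pi / 2"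
        unfolding eventually_at_filter
        by (rule eventually_mono) (use \<open>Ln ((\<gamma> s - lam j) / exp (q s)) = 0\<close> in auto)
      moreover have "\<forall>\<^sub>F z in nhds (\<gamma> s). z \<noteq> lam j"
        using in_img[OF s(1)] \<gamma>(1) by (intro t1_space_nhds) auto
      ultimately show ?thesis
      proof eventually_elim
        case (elim z)
        let ?l = "Ln ((z - lam j) / exp (q s))"
        have "\<bar>Im ?l\<bar> < pi / 2"
          using elim abs_Im_le_cmod[of ?l] by simp
        then have "Ln (exp (q s - q t + ?l)) = q s - q t + ?l"
          using im unfolding abs_less_iff by (intro Ln_exp) (simp only: plus_complex.sel, linarith)+
        moreover have "exp (q s - q t + ?l) = (z - lam j) / exp (q t)"
          using elim by (simp add: exp_add exp_diff)
        ultimately have "L s z = L t z"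
          by (simp add: L_def)
        then show ?case by (simp add: G_def)
      qed
    qed
    with \<delta>(1) show ?thesis by blast
  qed
  have ev_strip: "\<forall>\<^sub>F z in nhds (\<gamma> 0). z \<noteq> lam j \<and> L 0 z \<in> strip \<eta> (ln r)"
  proof -
    have "isCont (L 0) (\<gamma> 0)"
      using L_an[of 0] analytic_at_imp_isCont by simp
    then have "(L 0 \<longlongrightarrow> L 0 (\<gamma> 0)) (nhds (\<gamma> 0))"
      by (simp add: isCont_def tendsto_nhds_iff)
    then have "\<forall>\<^sub>F z in nhds (\<gamma> 0). L 0 z \<in> strip \<eta> (ln r)"
      using w0(1) q_0 L_self[of 0] by (intro topological_tendstoD open_strip) auto
    moreover have "\<forall>\<^sub>F z in nhds (\<gamma> 0). z \<noteq> lam j"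
      using in_img[of 0] \<gamma>(1) by (intro t1_space_nhds) auto
    ultimately show ?thesis by eventually_elim simp
  qed
  have expL: "lam j + exp (L 0 z) = z" if "z \<noteq> lam j" for z
    using that by (simp add: L_def exp_add)
  have G0: "\<forall>\<^sub>F z in nhds (\<gamma> 0). G 0 z = f z"
    using ev_strip by (rule eventually_mono) (auto simp: G_def vec_eq_iff \<Phi>f expL)
  have \<gamma>1: "\<gamma> 1 = \<gamma> 0" using path(2) by (simp add: pathstart_def pathfinish_def)
  have L1: "L 1 z = L 0 z + 2 * of_real pi * \<i>" for z
    unfolding L_def q_0 q_1 by (simp add: exp_add)
  have G1: "\<forall>\<^sub>F z in nhds (\<gamma> 1). G 1 z = g z"
    unfolding \<gamma>1 using ev_strip
    by (rule eventually_mono) (auto simp: G_def vec_eq_iff L1 \<Phi>g expL)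
  have "continuation_along \<gamma> f g"
    unfolding continuation_along_def using G_an G_loc G0 G1 by blast
  then show ?thesis
    unfolding loop_transform_def using g by blast
qed

section \<open>Local series\<close>

lemma cut_pow_add: "cut_pow \<eta> x (a + b) = cut_pow \<eta> x a * cut_pow \<eta> x b"
  by (simp add: cut_pow_def distrib_right exp_add)

lemma cut_pow_of_nat: "x \<noteq> 0 \<Longrightarrow> cut_pow \<eta> x (of_nat l) = x ^ l"
  by (simp add: cut_pow_def exp_of_nat_mult exp_cut_log)

lemma cut_pow_0 [simp]: "cut_pow \<eta> x 0 = 1"
  by (simp add: cut_pow_def)

lemma cut_pow_nonzero [simp]: "cut_pow \<eta> x a \<noteq> 0"
  by (simp add: cut_pow_def)

lemma cut_pow_minus: "cut_pow \<eta> x (- a) = inverse (cut_pow \<eta> x a)"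
  by (simp add: cut_pow_def exp_minus)

text \<open>Coefficientwise form of the equation that the derivative of x to the power \<beta> times
  the series of \<open>c\<close> is x to the power \<beta> times the series of \<open>d\<close>.
  Convergence of the second series comes from that of the differentiated first one, after division
  by \<open>x\<close>.\<close>

lemma powser_euler_relation:
  fixes c d :: "nat \<Rightarrow> complex"
  assumes conv: "\<And>x. norm x < e \<Longrightarrow> summable (\<lambda>l. c l * x ^ l)"
    and rel: "\<And>l. (\<beta> + of_nat l) * c l = (if l = 0 then 0 else d (l - 1))"
    and x: "norm x < e"
  shows "summable (\<lambda>l. d l * x ^ l)"
    and "\<beta> * (\<Sum>l. c l * x ^ l) + x * (\<Sum>l. diffs c l * x ^ l) = x * (\<Sum>l. d l * x ^ l)"
proof -
  let ?A = "\<Sum>l. c l * x ^ l" and ?B = "\<Sum>l. diffs c l * x ^ l"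
  have "summable (\<lambda>l. diffs c l * x ^ l)"
    using termdiff_converges[OF x conv] by simp
  then have "(\<lambda>l. of_nat l * c l * x ^ (l - Suc 0)) sums ?B"
    by (rule diffs_equiv)
  then have "(\<lambda>l. x * (of_nat l * c l * x ^ (l - Suc 0))) sums (x * ?B)"
    by (rule sums_mult)
  moreover have "x * (of_nat l * c l * x ^ (l - Suc 0)) = of_nat l * c l * x ^ l" for l
    by (cases l) auto
  ultimately have "(\<lambda>l. of_nat l * c l * x ^ l) sums (x * ?B)" by simp
  moreover have "(\<lambda>l. \<beta> * (c l * x ^ l)) sums (\<beta> * ?A)"
    by (intro sums_mult summable_sums conv x)
  ultimately have "(\<lambda>l. \<beta> * (c l * x ^ l) + of_nat l * c l * x ^ l) sums (\<beta> * ?A + x * ?B)"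
    by (intro sums_add)
  moreover have "\<beta> * (c l * x ^ l) + of_nat l * c l * x ^ l = (if l = 0 then 0 else d (l - 1)) * x ^ l" for l
    unfolding rel[of l, symmetric] by (simp add: algebra_simps)
  ultimately have "(\<lambda>l. (if l = 0 then 0 else d (l - 1)) * x ^ l) sums (\<beta> * ?A + x * ?B)"
    by simp
  then have "(\<lambda>l. d l * x ^ Suc l) sums (\<beta> * ?A + x * ?B)"
    using sums_Suc_iff[of "\<lambda>l. (if l = 0 then 0 else d (l - 1)) * x ^ l" "\<beta> * ?A + x * ?B"] by simp
  then have *: "(\<lambda>l. x * (d l * x ^ l)) sums (\<beta> * ?A + x * ?B)"
    by (simp add: mult_ac)
  show sm: "summable (\<lambda>l. d l * x ^ l)"
  proof (cases "x = 0")
    case False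
    from sums_mult[OF *, of "inverse x"] False show ?thesis
      by (simp add: mult.assoc[symmetric]) (simp add: sums_iff mult.assoc)
  qed (simp add: summable_0_powser)
  from sums_unique2[OF * sums_mult[OF summable_sums[OF sm], of x]]
  show "\<beta> * ?A + x * ?B = x * (\<Sum>l. d l * x ^ l)" .
qed

text \<open>The power is moved to the side of \<open>f\<close>, so that what is summed is an
  ordinary power series, whatever the exponent \<beta>. Global holomorphy is included so that the
  coefficients determine \<open>f\<close> on the whole cut plane.\<close>

definition local_series ::
    "('n::finite \<Rightarrow> complex) \<Rightarrow> real \<Rightarrow> 'n \<Rightarrow> complex \<Rightarrow> (nat \<Rightarrow> complex) \<Rightarrow> (complex \<Rightarrow> complex) \<Rightarrow> bool" where
  "local_series lam \<eta> m \<beta> c f \<longleftrightarrow> f holomorphic_on cut_plane lam \<eta> \<and>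
     (\<exists>e>0. \<forall>z\<in>cut_plane lam \<eta> \<inter> ball (lam m) e.
        (\<lambda>l. c l * (z - lam m) ^ l) sums (f z * cut_pow \<eta> (z - lam m) (- \<beta>)))"

section \<open>Functions determined by their series at a pole\<close>

locale cut_system =
  fixes lam :: "'n::finite \<Rightarrow> complex" and \<eta> :: real
  assumes inj_lam: "inj lam" and adm: "admissible lam \<eta>"
begin

abbreviation "P \<equiv> cut_plane lam \<eta>"

lemma pole_notin_P: "lam m \<notin> P"
proof -
  have "lam m \<in> cut lam \<eta> m" by (simp add: mem_cut_iff)
  then show ?thesis by (auto simp: cut_plane_def)
qed

lemma identity_at_pole:
  assumes "f holomorphic_on P" "g holomorphic_on P" "e > 0"
    and "\<And>z. z \<in> P \<Longrightarrow> z \<in> ball (lam m) e \<Longrightarrow> f z = g z" and "z \<in> P"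
  shows "f z = g z"
proof (rule analytic_continuation_open[where s = "P \<inter> ball (lam m) e" and s' = P and f = f and g = g])
  have "lam m - of_real (e / 2) * cis \<eta> \<in> P \<inter> ball (lam m) e"
    using admissible_backward_mem_cut_plane[OF inj_lam adm, of "e / 2" m] assms(3)
    by (simp add: dist_norm norm_mult)
  then show "P \<inter> ball (lam m) e \<noteq> {}" by blast
qed (use assms open_cut_plane connected_cut_plane in auto)

text \<open>Convergence is given only at points of the cut plane, but the backward ray from the pole
  supplies such a point at every distance below the radius, and a power series converges at all
  points closer to its centre.\<close>

lemma local_seriesE:
  assumes "local_series lam \<eta> m \<beta> c f"
  obtains e where "e > 0" "\<And>x. norm x < e \<Longrightarrow> summable (\<lambda>l. c l * x ^ l)"
    "\<And>z. z \<in> P \<Longrightarrow> z \<in> ball (lam m) e \<Longrightarrow>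
       f z = cut_pow \<eta> (z - lam m) \<beta> * (\<Sum>l. c l * (z - lam m) ^ l)"
proof -
  obtain e where e: "e > 0" "\<And>z. z \<in> P \<Longrightarrow> z \<in> ball (lam m) e \<Longrightarrow>
      (\<lambda>l. c l * (z - lam m) ^ l) sums (f z * cut_pow \<eta> (z - lam m) (- \<beta>))"
    using assms unfolding local_series_def by blast
  have "summable (\<lambda>l. c l * x ^ l)" if x: "norm x < e" for x
  proof -
    define t where "t = (norm x + e) / 2"
    have t: "norm x < t" "t < e" "t > 0"
      using x e(1) norm_ge_zero[of x] by (auto simp: t_def simp del: norm_ge_zero)
    define z where "z = lam m - of_real t * cis \<eta>"
    have "z \<in> P" "z \<in> ball (lam m) e"
      using t admissible_backward_mem_cut_plane[OF inj_lam adm t(3)]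
      by (auto simp: z_def dist_norm norm_mult)
    then have "summable (\<lambda>l. c l * (z - lam m) ^ l)"
      using e(2) sums_summable by blast
    then show ?thesis
      by (rule powser_inside) (use t in \<open>simp add: z_def norm_mult\<close>)
  qed
  moreover have "f z = cut_pow \<eta> (z - lam m) \<beta> * (\<Sum>l. c l * (z - lam m) ^ l)"
    if "z \<in> P" "z \<in> ball (lam m) e" for z
    using sums_unique[OF e(2)[OF that], symmetric] by (simp add: cut_pow_minus field_simps)
  ultimately show ?thesis using that e(1) by blast
qed

lemma local_series_unique:
  assumes "local_series lam \<eta> m \<beta> c f" "local_series lam \<eta> m \<beta> c g" "z \<in> P"
  shows "f z = g z"
proof -
  obtain e1 where e1: "e1 > 0" "\<And>x. norm x < e1 \<Longrightarrow> summable (\<lambda>l. c l * x ^ l)" "\<And>z. z \<in> P \<Longrightarrow> z \<in> ball (lam m) e1 \<Longrightarrow>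
       f z = cut_pow \<eta> (z - lam m) \<beta> * (\<Sum>l. c l * (z - lam m) ^ l)"
    using local_seriesE[OF assms(1)] by blast
  obtain e2 where e2: "e2 > 0" "\<And>x. norm x < e2 \<Longrightarrow> summable (\<lambda>l. c l * x ^ l)" "\<And>z. z \<in> P \<Longrightarrow> z \<in> ball (lam m) e2 \<Longrightarrow>
       g z = cut_pow \<eta> (z - lam m) \<beta> * (\<Sum>l. c l * (z - lam m) ^ l)"
    using local_seriesE[OF assms(2)] by blast
  show ?thesis
  proof (rule identity_at_pole[of f g "min e1 e2" m])
    show "f holomorphic_on P" "g holomorphic_on P"
      using assms by (auto simp: local_series_def)
  qed (use assms(3) e1(1,3) e2(1,3) in auto)
qed

text \<open>Termwise differentiation. The exponent \<beta> is kept, so the term of relative order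
  -1, whose coefficient is \<open>\<beta> * c 0\<close>, has to vanish: this is the case
  \<open>l = 0\<close> of the relation.\<close>

lemma local_series_deriv:
  assumes f: "local_series lam \<eta> m \<beta> c f"
    and rel: "\<And>l. (\<beta> + of_nat l) * c l = (if l = 0 then 0 else d (l - 1))"
  shows "local_series lam \<eta> m \<beta> d (deriv f)"
proof -
  obtain e where e: "e > 0" and conv: "\<And>x. norm x < e \<Longrightarrow> summable (\<lambda>l. c l * x ^ l)"
    and feq: "\<And>z. z \<in> P \<Longrightarrow> z \<in> ball (lam m) e \<Longrightarrow>
       f z = cut_pow \<eta> (z - lam m) \<beta> * (\<Sum>l. c l * (z - lam m) ^ l)"
    using local_seriesE[OF f] by blast
  have "(\<lambda>l. d l * (z - lam m) ^ l) sums (deriv f z * cut_pow \<eta> (z - lam m) (- \<beta>))"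
    if z: "z \<in> P" "z \<in> ball (lam m) e" for z
  proof -
    define x where "x = z - lam m"
    have x: "norm x < e" "x \<noteq> 0"
      using z pole_notin_P[of m] by (auto simp: x_def dist_norm norm_minus_commute)
    let ?A = "\<Sum>l. c l * x ^ l" and ?B = "\<Sum>l. diffs c l * x ^ l"
    have ps: "((\<lambda>z. \<Sum>l. c l * (z - lam m) ^ l) has_field_derivative ?B) (at z)"
    proof -
      have "((\<lambda>x. \<Sum>l. c l * x ^ l) has_field_derivative ?B) (at (z - lam m))"
        using termdiffs_strong'[OF conv x(1)] by (simp add: x_def)
      moreover have "((\<lambda>z. z - lam m) has_field_derivative 1) (at z)"
        by (auto intro!: derivative_eq_intros)
      ultimately show ?thesis
        using DERIV_chain2[of "\<lambda>x. \<Sum>l. c l * x ^ l" ?B "\<lambda>z. z - lam m" z 1] by simp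
    qed
    have pw: "((\<lambda>z. cut_pow \<eta> (z - lam m) \<beta>) has_field_derivative cut_pow \<eta> x \<beta> * (\<beta> / x)) (at z)"
      unfolding cut_pow_def x_def
      using has_field_derivative_cut_log[OF z(1), of m]
      by (auto intro!: derivative_eq_intros)
    have "((\<lambda>z. cut_pow \<eta> (z - lam m) \<beta> * (\<Sum>l. c l * (z - lam m) ^ l))
        has_field_derivative cut_pow \<eta> x \<beta> * (\<beta> / x) * ?A + ?B * cut_pow \<eta> x \<beta>) (at z)"
      using DERIV_mult[OF pw ps] by (simp add: x_def)
    then have "(f has_field_derivative cut_pow \<eta> x \<beta> * (\<beta> / x) * ?A + ?B * cut_pow \<eta> x \<beta>) (at z)"
    proof (rule has_field_derivative_transform_within_open[where S = "P \<inter> ball (lam m) e"])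
      show "open (P \<inter> ball (lam m) e)" using open_cut_plane by auto
    qed (use z feq in auto)
    then have "deriv f z = cut_pow \<eta> x \<beta> * ((\<beta> * ?A + x * ?B) / x)"
      using x(2) by (simp add: DERIV_imp_deriv field_simps)
    also have "(\<beta> * ?A + x * ?B) / x = (\<Sum>l. d l * x ^ l)"
      using powser_euler_relation(2)[OF conv rel x(1)] x(2) by simp
    finally have "deriv f z * cut_pow \<eta> x (- \<beta>) = (\<Sum>l. d l * x ^ l)"
      by (simp add: cut_pow_minus)
    with summable_sums[OF powser_euler_relation(1)[OF conv rel x(1)]]
    show ?thesis by (simp add: x_def)
  qed
  moreover have "deriv f holomorphic_on P"
    using f open_cut_plane by (intro holomorphic_deriv) (auto simp: local_series_def)
  ultimately show ?thesis
    unfolding local_series_def using e by blast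
qed

end

section \<open>Coefficients\<close>

text \<open>Zero at negative indices, so that one index formula covers the truncated series of the
  primitives, the shift by an integer exponent of either sign, and the recurrence at its lower
  end.\<close>

definition int_fcol :: "complex fps^'n^'n \<Rightarrow> 'n \<Rightarrow> int \<Rightarrow> complex^'n" where
  "int_fcol F m n = (if n < 0 then 0 else fcol F m (nat n))"

lemma int_fcol_of_nat: "int_fcol F m (int n) = fcol F m n"
  by (simp add: int_fcol_def)

text \<open>Comparison of the coefficients of order \<open>n + 1\<close> in \<open>1/z\<close>, in
  row \<open>i\<close> and column \<open>m\<close> of the equation for the formal solution.\<close>

lemma formal_solution_recurrence:
  assumes F: "formal_solution lam A1 F"
  shows "(lam i - lam m) * int_fcol F m (n + 1) $ i
     = (A1 $ m $ m - of_int n) * int_fcol F m n $ i - (\<Sum>j\<in>UNIV. A1 $ i $ j * int_fcol F m n $ j)"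
proof -
  let ?f = "\<lambda>i m. fps_nth (F $ i $ m)"
  have entry: "- (fps_X ^ 2) * fps_deriv (F $ i $ m)
      + (\<Sum>j\<in>UNIV. F $ i $ j * (fps_const (if j = m then lam j else 0)
          + fps_X * fps_const (if j = m then A1 $ j $ j else 0)))
      = (\<Sum>j\<in>UNIV. (fps_const (if i = j then lam i else 0) + fps_X * fps_const (A1 $ i $ j)) * F $ j $ m)"
  proof -
    have mat_X: "(mat fps_X ** B) $ i $ j = fps_X * (B $ i $ j)" for B :: "complex fps^'n^'n" and i j
      by (simp add: matrix_matrix_mult_def mat_def if_distrib[of "\<lambda>x. x * _"] cong: if_cong)
    have "((\<chi> i j. - (fps_X ^ 2) * fps_deriv (F $ i $ j))
       + F ** (fps_mat (diag lam) + mat fps_X ** fps_mat (diag (\<lambda>k. A1 $ k $ k)))) $ i $ m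
     = ((fps_mat (diag lam) + mat fps_X ** fps_mat A1) ** F) $ i $ m"
      using F unfolding formal_solution_def by simp
    then show ?thesis
      unfolding matrix_matrix_mult_def[of F] matrix_matrix_mult_def[of "_ + _"]
      by (simp add: mat_X) (simp add: fps_mat_def diag_def)
  qed
  have dm: "F $ i $ j * (fps_const (if j = m then lam j else 0) + fps_X * fps_const (if j = m then A1 $ j $ j else 0))
      = (if j = m then F $ i $ m * (fps_const (lam m) + fps_X * fps_const (A1 $ m $ m)) else 0)" for j
    by (cases "j = m") simp_all
  have di: "(fps_const (if i = j then lam i else 0) + fps_X * fps_const (A1 $ i $ j)) * F $ j $ m
      = (if i = j then fps_const (lam i) * F $ i $ m else 0) + fps_X * (fps_const (A1 $ i $ j) * F $ j $ m)" for j
    by (cases "i = j") (simp_all add: distrib_right mult.assoc)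
  have s1: "(\<Sum>j\<in>UNIV. F $ i $ j * (fps_const (if j = m then lam j else 0)
          + fps_X * fps_const (if j = m then A1 $ j $ j else 0)))
      = F $ i $ m * (fps_const (lam m) + fps_X * fps_const (A1 $ m $ m))"
    unfolding dm by (rule sum.delta[THEN trans]) simp_all
  have s2: "(\<Sum>j\<in>UNIV. (fps_const (if i = j then lam i else 0) + fps_X * fps_const (A1 $ i $ j)) * F $ j $ m)
      = fps_const (lam i) * F $ i $ m + fps_X * (\<Sum>j\<in>UNIV. fps_const (A1 $ i $ j) * F $ j $ m)"
    unfolding di sum.distrib sum_distrib_left[symmetric]
    by (rule arg_cong2[where f = "(+)"], rule sum.delta'[THEN trans]) simp_all
  note eq = entry[unfolded s1 s2]
  have eq': "fps_const (lam m) * F $ i $ m + fps_X * (fps_const (A1 $ m $ m) * F $ i $ m)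
        - fps_X * (fps_X * fps_deriv (F $ i $ m))
      = fps_const (lam i) * F $ i $ m + fps_X * (\<Sum>j\<in>UNIV. fps_const (A1 $ i $ j) * F $ j $ m)"
  proof -
    have "a * f + x * (b * f) - x * (x * d) = - (x ^ 2) * d + f * (a + x * b)"
      for x d f a b :: "complex fps"
      by (simp add: algebra_simps power2_eq_square)
    from this[of "fps_const (lam m)" "F $ i $ m" fps_X "fps_const (A1 $ m $ m)" "fps_deriv (F $ i $ m)"]
    show ?thesis using eq by (rule trans)
  qed
  have c0: "lam m * ?f i m 0 = lam i * ?f i m 0"
    using arg_cong[OF eq', of "\<lambda>g. fps_nth g 0"] by simp
  have cS: "lam m * ?f i m (Suc l) + A1 $ m $ m * ?f i m l - of_nat l * ?f i m l
      = lam i * ?f i m (Suc l) + (\<Sum>j\<in>UNIV. A1 $ i $ j * ?f j m l)" for l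
    using arg_cong[OF eq', of "\<lambda>g. fps_nth g (Suc l)"]
    by (cases l) (simp_all add: fps_sum_nth)
  \<comment> \<open>The value -1 is the comparison of constant coefficients; below it every term is
    zero by the convention on negative indices.\<close>
  consider "n < -1" | "n = -1" | l where "n = int l"
    by (metis linorder_neqE_linordered_idom nonneg_int_cases zless_imp_add1_zle add.right_inverse add.commute minus_add_cancel not_less)
  then show ?thesis
  proof cases
    case 1
    then show ?thesis by (simp add: int_fcol_def)
  next
    case 2
    then show ?thesis using c0 by (auto simp: int_fcol_def fcol_def)
  next
    case 3
    have "int_fcol F m (n + 1) = fcol F m (Suc l)" "int_fcol F m n = fcol F m l"
      using 3 by (auto simp: int_fcol_def nat_add_distrib)
    then show ?thesis using cS[of l] 3 by (simp add: fcol_def algebra_simps)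
  qed
qed

definition expo :: "complex^'n^'n \<Rightarrow> 'n \<Rightarrow> complex" where
  "expo A1 m = (if A1 $ m $ m \<in> \<int> then 0 else - A1 $ m $ m - 1)"

text \<open>The coefficient of order \<open>l\<close>, after splitting off the power with exponent
  \<open>expo A1 m\<close>, in the \<open>p\<close>-th primitive of \<open>\<Psi>\<^sub>m\<close>.
  For an integer exponent the powers are reindexed to start at 0, which shifts the column index by
  \<open>NN A1 m + 1\<close>: for \<open>\<lambda>'\<^sub>m\<close> in \<nat> the index
  \<open>p = 0\<close> gives \<open>\<Psi>\<^sub>m\<close> and \<open>p = NN A1 m + 1\<close> the
  hatted function, while for negative integers the first coefficients are zero.\<close>

definition coef :: "complex^'n^'n \<Rightarrow> complex fps^'n^'n \<Rightarrow> 'n \<Rightarrow> nat \<Rightarrow> nat \<Rightarrow> complex^'n" where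
  "coef A1 F m p l =
     (if A1 $ m $ m \<in> \<int> then
        ((-1) ^ (l + 1 + p) / fact l) *s int_fcol F m (int l + NN A1 m + 1 - int p)
      else ((-1) ^ p * Gamma (A1 $ m $ m + 1 - of_nat l)) *s int_fcol F m (int l - int p))"

lemma NN_eq: "A1 $ m $ m \<in> \<int> \<Longrightarrow> A1 $ m $ m = of_int (NN A1 m)"
  by (auto simp: NN_def elim: Ints_cases)

lemma Gamma_shift:
  assumes "a \<notin> \<int>"
  shows "Gamma (a + 1 - of_nat l) = (a - of_nat l) * Gamma (a - of_nat l)"
proof -
  have "a - of_nat l \<notin> \<int>" using assms Ints_add[of "a - of_nat l" "of_nat l"] by auto
  then have "a - of_nat l \<notin> \<int>\<^sub>\<le>\<^sub>0" using nonpos_Ints_Int by blast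
  from Gamma_plus1[OF this] show ?thesis by (simp add: algebra_simps)
qed

lemma Suc_mult_divide_fact: "of_nat (Suc l) * (x / fact (Suc l)) = (x / fact l :: 'a::field_char_0)"
  by (simp only: fact_Suc of_nat_mult) (simp del: of_nat_Suc)

text \<open>The relation required for termwise differentiation: level \<open>p\<close> is the
  derivative of level \<open>Suc p\<close>. It is the functional equation of the factorial or of
  Gamma, the latter with a sign absorbed by the power of -1. At \<open>l = 0\<close> either the
  factor on the left or the coefficient is zero.\<close>

lemma coef_euler:
  "(expo A1 m + of_nat l) * coef A1 F m (Suc p) l $ i = (if l = 0 then 0 else coef A1 F m p (l - 1) $ i)"
proof (cases "A1 $ m $ m \<in> \<int>")
  case True
  show ?thesis
  proof (cases l)
    case 0
    with True show ?thesis by (simp add: expo_def)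
  next
    case (Suc l')
    have e: "int (Suc l') + NN A1 m + 1 - int (Suc p) = int l' + NN A1 m + 1 - int p"
      by simp
    have "(expo A1 m + of_nat l) * coef A1 F m (Suc p) l $ i
        = of_nat (Suc l') * ((-1) ^ (l' + 1 + p) / fact (Suc l')) * int_fcol F m (int l' + NN A1 m + 1 - int p) $ i"
      using True unfolding Suc expo_def coef_def e by (simp del: fact_Suc of_nat_Suc)
    then show ?thesis
      unfolding Suc_mult_divide_fact using True Suc by (simp add: coef_def)
  qed
next
  case False
  show ?thesis
  proof (cases l)
    case 0
    with False show ?thesis by (simp add: coef_def int_fcol_def)
  next
    case (Suc l')
    have e: "int l - int (Suc p) = int l' - int p" using Suc by simp
    have "Gamma (A1 $ m $ m + 1 - of_nat l') = (A1 $ m $ m - of_nat l') * Gamma (A1 $ m $ m + 1 - of_nat l)"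
      using Gamma_shift[OF False, of l'] Suc by (simp add: algebra_simps)
    then have "coef A1 F m p l' $ i
        = (-1) ^ p * ((A1 $ m $ m - of_nat l') * Gamma (A1 $ m $ m + 1 - of_nat l)) * int_fcol F m (int l' - int p) $ i"
      using False by (simp add: coef_def)
    moreover have "coef A1 F m (Suc p) l $ i
        = - ((-1) ^ p * Gamma (A1 $ m $ m + 1 - of_nat l) * int_fcol F m (int l' - int p) $ i)"
      using False unfolding coef_def e by simp
    moreover have "expo A1 m + of_nat l = - (A1 $ m $ m - of_nat l')"
      using False Suc by (simp add: expo_def)
    ultimately have "(expo A1 m + of_nat l) * coef A1 F m (Suc p) l $ i = coef A1 F m p l' $ i"
      by (simp only: minus_mult_minus mult_ac)
    then show ?thesis by (simp only: Suc diff_Suc_1 nat.distinct if_False)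
  qed
qed

text \<open>The recurrence of the formal solution, multiplied by the factorial or Gamma factor. In
  terms of series it is (F) integrated once, namely \<open>(lam i - z)\<close> times the function
  equal to \<open>A1\<close> times its primitive.\<close>

lemma coef_ode:
  assumes "formal_solution lam A1 F"
  shows "(lam i - lam m) * coef A1 F m 0 l $ i - (if l = 0 then 0 else coef A1 F m 0 (l - 1) $ i)
     = (\<Sum>j\<in>UNIV. A1 $ i $ j * coef A1 F m 1 l $ j)"
proof (cases "A1 $ m $ m \<in> \<int>")
  case True
  define g :: complex where "g = (-1) ^ (l + 1) / fact l"
  define n where "n = int l + NN A1 m"
  have a: "coef A1 F m 0 l = g *s int_fcol F m (n + 1)" "coef A1 F m 1 l = - g *s int_fcol F m n"
    using True by (simp_all add: coef_def g_def n_def algebra_simps)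
  have b: "(if l = 0 then 0 else coef A1 F m 0 (l - 1) $ i) = - g * of_nat l * int_fcol F m n $ i"
  proof (cases l)
    case (Suc l')
    have "- g * of_nat l = of_nat (Suc l') * ((-1) ^ (l' + 1) / fact (Suc l'))"
      using Suc by (simp add: g_def del: fact_Suc of_nat_Suc)
    then show ?thesis
      unfolding Suc_mult_divide_fact using True Suc by (simp add: coef_def n_def algebra_simps)
  qed simp
  have "A1 $ m $ m - of_int n = - of_nat l"
    using NN_eq[OF True] by (simp add: n_def)
  from arg_cong[OF formal_solution_recurrence[OF assms, of i m n, unfolded this], of "\<lambda>x. g * x"]
  have "g * ((lam i - lam m) * int_fcol F m (n + 1) $ i) + g * of_nat l * int_fcol F m n $ i
      = - g * (\<Sum>j\<in>UNIV. A1 $ i $ j * int_fcol F m n $ j)"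
    by (simp add: algebra_simps)
  then show ?thesis
    unfolding a b by (simp add: sum_distrib_left mult_ac)
next
  case False
  define g where "g = Gamma (A1 $ m $ m + 1 - of_nat l)"
  define n where "n = int l - 1"
  have a: "coef A1 F m 0 l = g *s int_fcol F m (n + 1)" "coef A1 F m 1 l = - g *s int_fcol F m n"
    using False by (simp_all add: coef_def g_def n_def algebra_simps)
  have b: "(if l = 0 then 0 else coef A1 F m 0 (l - 1) $ i) = g * (A1 $ m $ m + 1 - of_nat l) * int_fcol F m n $ i"
  proof (cases l)
    case 0
    then show ?thesis by (simp add: n_def int_fcol_def)
  next
    case (Suc l')
    have "Gamma (A1 $ m $ m + 1 - of_nat l') = (A1 $ m $ m - of_nat l') * g"
      using Gamma_shift[OF False, of l'] Suc by (simp add: g_def algebra_simps)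
    then have "coef A1 F m 0 l' $ i = (A1 $ m $ m - of_nat l') * g * int_fcol F m n $ i"
      using False Suc by (simp add: coef_def n_def)
    then show ?thesis using Suc by simp
  qed
  have "A1 $ m $ m - of_int n = A1 $ m $ m + 1 - of_nat l" by (simp add: n_def)
  from arg_cong[OF formal_solution_recurrence[OF assms, of i m n, unfolded this], of "\<lambda>x. g * x"]
  have "g * ((lam i - lam m) * int_fcol F m (n + 1) $ i) - g * (A1 $ m $ m + 1 - of_nat l) * int_fcol F m n $ i
      = - g * (\<Sum>j\<in>UNIV. A1 $ i $ j * int_fcol F m n $ j)"
    by (simp add: algebra_simps)
  then show ?thesis
    unfolding a b by (simp add: sum_distrib_left mult_ac)
qed

section \<open>Iterated primitives\<close>

lemma eq_mod_reg_nth: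
  assumes "eq_mod_reg P a f g"
  shows "\<exists>r e. r analytic_on {a} \<and> 0 < e \<and> (\<forall>z\<in>P \<inter> ball a e. f z $ i = g z $ i + r z)"
proof -
  obtain r e where r: "vanalytic_at r a" "e > 0" "\<And>z. z \<in> P \<inter> ball a e \<Longrightarrow> f z = g z + r z"
    using assms unfolding eq_mod_reg_def by blast
  have "(\<lambda>z. r z $ i) analytic_on {a}" using r(1) by (simp add: vanalytic_at_def)
  moreover have "\<forall>z\<in>P \<inter> ball a e. f z $ i = g z $ i + r z $ i" using r(3) by simp
  ultimately show ?thesis using r(2) by blast
qed

locale connection_system = cut_system lam \<eta>
  for lam :: "'n::finite \<Rightarrow> complex" and \<eta> :: real +
  fixes A1 :: "complex^'n^'n"
    and F :: "complex fps^'n^'n"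
    and Psi :: "'n \<Rightarrow> complex \<Rightarrow> complex^'n"
    and Psi_prim hat :: "nat \<Rightarrow> 'n \<Rightarrow> complex \<Rightarrow> complex^'n"
  assumes formal: "formal_solution lam A1 F"
    and Psi: "\<And>m. is_Psi lam A1 \<eta> F m (Psi m)"
    and Psi_prim: "\<And>p m. A1 $ m $ m \<notin> \<nat> \<Longrightarrow> is_Psi_prim lam A1 \<eta> F p m (Psi_prim p m)"
    and hat: "\<And>p m. A1 $ m $ m \<in> \<nat> \<Longrightarrow> is_hat_prim lam A1 \<eta> F p m (hat p m)"
begin

section \<open>The given series in one common normal form\<close>

lemma local_series_of_terms:
  assumes f: "continues_series P (lam m) u f"
    and u: "\<And>z S. z \<in> P \<Longrightarrow> z \<noteq> lam m \<Longrightarrow> (\<lambda>l. u l z $ i) sums S \<Longrightarrow>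
      (\<lambda>l. c l * (z - lam m) ^ l) sums (S * cut_pow \<eta> (z - lam m) (- \<beta>))"
  shows "local_series lam \<eta> m \<beta> c (\<lambda>z. f z $ i)"
proof -
  obtain e where e: "e > 0" "\<And>z. z \<in> P \<inter> ball (lam m) e \<Longrightarrow> (\<lambda>l. u l z) sums f z"
    using f unfolding continues_series_def by blast
  have "(\<lambda>l. c l * (z - lam m) ^ l) sums (f z $ i * cut_pow \<eta> (z - lam m) (- \<beta>))"
    if z: "z \<in> P \<inter> ball (lam m) e" for z
  proof (rule u)
    show "(\<lambda>l. u l z $ i) sums (f z $ i)"
      by (rule bounded_linear.sums[OF bounded_linear_vec_nth e(2)[OF z]])
    show "z \<noteq> lam m" "z \<in> P" using z pole_notin_P by auto
  qed
  then show ?thesis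
    using e(1) f unfolding local_series_def continues_series_def vholomorphic_on_def by blast
qed

lemma prim_local_series:
  assumes "is_Psi_prim lam A1 \<eta> F p m f" "A1 $ m $ m \<notin> \<nat>"
  shows "local_series lam \<eta> m (expo A1 m) (\<lambda>l. coef A1 F m p l $ i) (\<lambda>z. f z $ i)"
proof (rule local_series_of_terms)
  show "continues_series P (lam m) (Psi_prim_term lam A1 \<eta> F p m) f"
    using assms(1) by (simp add: is_Psi_prim_def)
next
  fix z S
  assume z: "z \<noteq> lam m" and S: "(\<lambda>l. Psi_prim_term lam A1 \<eta> F p m l z $ i) sums S"
  let ?x = "z - lam m" and ?a = "A1 $ m $ m"
  show "(\<lambda>l. coef A1 F m p l $ i * ?x ^ l) sums (S * cut_pow \<eta> ?x (- expo A1 m))"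
  proof (cases "?a \<in> \<int>")
    case False
    have "Psi_prim_term lam A1 \<eta> F p m l z $ i * cut_pow \<eta> ?x (- expo A1 m) = coef A1 F m p l $ i * ?x ^ l" for l
    proof (cases "l < p")
      case True
      with False show ?thesis by (simp add: Psi_prim_term_def coef_def int_fcol_def)
    next
      case lp: False
      have "of_nat l - ?a - 1 = of_nat l + expo A1 m"
        using False by (simp add: expo_def)
      then have "cut_pow \<eta> ?x (of_nat l - ?a - 1) = ?x ^ l * cut_pow \<eta> ?x (expo A1 m)"
        using z by (simp only: cut_pow_add) (simp add: cut_pow_of_nat)
      moreover have "nat (int l - int p) = l - p" using lp by simp
      ultimately show ?thesis
        using False lp by (simp add: Psi_prim_term_def coef_def int_fcol_def cut_pow_minus)
    qed
    with sums_mult2[OF S, of "cut_pow \<eta> ?x (- expo A1 m)"] show ?thesis by simp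
  next
    case True
    define N where "N = NN A1 m"
    have a: "?a = of_int N" using NN_eq[OF True] by (simp add: N_def)
    have N: "N < 0"
    proof (rule ccontr)
      assume "\<not> N < 0"
      then have "?a = of_nat (nat N)" using a by simp
      with assms(2) show False using of_nat_in_Nats by metis
    qed
    \<comment> \<open>For a negative integer exponent the given series starts with the power
      \<open>- N - 1\<close>. Its \<open>l\<close>-th term is the one of index \<open>l + K\<close>
      in the normal form, and the terms below \<open>K\<close> vanish there.\<close>
    define K where "K = nat (- N - 1)"
    have K: "int K = - N - 1" using N by (simp add: K_def)
    have e0: "expo A1 m = 0" using True by (simp add: expo_def)
    have shift: "coef A1 F m p (l + K) $ i * ?x ^ (l + K) = Psi_prim_term lam A1 \<eta> F p m l z $ i" for l
    proof (cases "l < p")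
      case lp: True
      with True K show ?thesis by (simp add: Psi_prim_term_def coef_def int_fcol_def N_def)
    next
      case lp: False
      have n: "nat (int l - N - 1) = l + K" "nat (int l - N) = l + K + 1"
        using K by linarith+
      have idx: "int (l + K) + N + 1 - int p = int (l - p)"
        using K lp by simp
      have sign: "(-1 :: complex) ^ (l + K + 1 + p) = (-1) ^ p * (-1) ^ (l + K + 1)"
        by (simp add: power_add)
      show ?thesis
        using True lp
        by (simp only: Psi_prim_term_def coef_def if_True if_False not_True_eq_False vector_smult_component
            N_def[symmetric] n idx sign int_fcol_of_nat) simp
    qed
    have zero: "coef A1 F m p l $ i * ?x ^ l = 0" if "l < K" for l
      using that True K by (simp add: coef_def int_fcol_def N_def)
    have "(\<lambda>l. coef A1 F m p (l + K) $ i * ?x ^ (l + K)) sums S"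
      using S by (simp add: shift)
    then have "(\<lambda>l. coef A1 F m p l $ i * ?x ^ l) sums S"
      using sums_zero_iff_shift[of K "\<lambda>l. coef A1 F m p l $ i * ?x ^ l" S, OF zero] by simp
    then show ?thesis by (simp add: e0)
  qed
qed

text \<open>The index reflects that the hatted function is itself the primitive of order
  \<open>NN A1 m + 1\<close> of \<open>\<Psi>\<^sub>m\<close>.\<close>

lemma hat_local_series:
  assumes "is_hat_prim lam A1 \<eta> F q m f" "A1 $ m $ m \<in> \<nat>"
  shows "local_series lam \<eta> m (expo A1 m) (\<lambda>l. coef A1 F m (q + 1 + nat (NN A1 m)) l $ i) (\<lambda>z. f z $ i)"
proof (rule local_series_of_terms)
  show "continues_series P (lam m) (hat_prim_term lam A1 F q m) f"
    using assms(1) by (simp add: is_hat_prim_def)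
next
  fix z S
  assume S: "(\<lambda>l. hat_prim_term lam A1 F q m l z $ i) sums S"
  have int: "A1 $ m $ m \<in> \<int>" using assms(2) Nats_subset_Ints by blast
  define N where "N = nat (NN A1 m)"
  have N: "NN A1 m = int N"
    using assms(2) by (auto simp: N_def NN_def elim!: Nats_cases)
  have "hat_prim_term lam A1 F q m l z $ i = coef A1 F m (q + 1 + N) l $ i * (z - lam m) ^ l" for l
  proof (cases "l < q")
    case True
    then show ?thesis using int N by (simp add: hat_prim_term_def coef_def int_fcol_def)
  next
    case False
    have idx: "int l + NN A1 m + 1 - int (q + 1 + N) = int (l - q)"
      using False N by simp
    have sign: "(-1 :: complex) ^ (l + 1 + (q + 1 + N)) = (-1) ^ q * (-1) ^ (l + N)"
      by (simp add: power_add)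
    show ?thesis
      using int False
      by (simp only: hat_prim_term_def coef_def if_True if_False vector_smult_component
          N_def[symmetric] idx sign int_fcol_of_nat) simp
  qed
  with S show "(\<lambda>l. coef A1 F m (q + 1 + nat (NN A1 m)) l $ i * (z - lam m) ^ l) sums
      (S * cut_pow \<eta> (z - lam m) (- expo A1 m))"
    using int by (simp add: expo_def N_def)
qed

text \<open>For every pole \<open>m\<close>, the functions \<open>branch p m\<close> are successive primitives of \<open>\<Psi>\<^sub>m\<close>, whatever
  the type of the exponent \<open>\<lambda>'\<^sub>m\<close>.\<close>

definition branch :: "nat \<Rightarrow> 'n \<Rightarrow> complex \<Rightarrow> complex^'n" where
  "branch p m = (if A1 $ m $ m \<in> \<nat> then hat_bracket hat m (NN A1 m + 1 - int p) else Psi_prim p m)"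

text \<open>When \<open>\<lambda>'\<^sub>m\<close> is in \<nat>, the levels up to \<open>N\<close>
  are derivatives of the hatted function and are reached downwards from level \<open>N + 1\<close>
  by termwise differentiation; all other levels are given by their series directly.\<close>

lemma branch_local_series:
  "local_series lam \<eta> m (expo A1 m) (\<lambda>l. coef A1 F m p l $ i) (\<lambda>z. branch p m z $ i)"
proof (cases "A1 $ m $ m \<in> \<nat>")
  case False
  then show ?thesis
    using prim_local_series[OF Psi_prim[OF False] False] by (simp add: branch_def)
next
  case True
  define N where "N = nat (NN A1 m)"
  have N: "NN A1 m = int N"
    using True by (auto simp: N_def NN_def elim!: Nats_cases)
  have derivs: "local_series lam \<eta> m (expo A1 m) (\<lambda>l. coef A1 F m (N + 1 - s) l $ i)
      (\<lambda>z. (vderiv ^^ s) (hat 0 m) z $ i)" if "s \<le> N + 1" for s i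
    using that
  proof (induction s arbitrary: i)
    case 0
    show ?case using hat_local_series[OF hat[OF True] True, of 0 i] by (simp add: N_def)
  next
    case (Suc s)
    have p: "N + 1 - s = Suc (N + 1 - Suc s)" using Suc.prems by simp
    have "local_series lam \<eta> m (expo A1 m) (\<lambda>l. coef A1 F m (N + 1 - Suc s) l $ i)
       (deriv (\<lambda>z. (vderiv ^^ s) (hat 0 m) z $ i))"
    proof (rule local_series_deriv)
      show "local_series lam \<eta> m (expo A1 m) (\<lambda>l. coef A1 F m (N + 1 - s) l $ i)
          (\<lambda>z. (vderiv ^^ s) (hat 0 m) z $ i)"
        using Suc by simp
    qed (unfold p, rule coef_euler)
    moreover have "(\<lambda>z. vderiv g z $ i) = deriv (\<lambda>z. g z $ i)" for g :: "complex \<Rightarrow> complex^'n"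
      by (simp add: vderiv_def)
    ultimately show ?case by simp
  qed
  show ?thesis
  proof (cases "p \<le> N")
    case p: True
    then have "branch p m = (vderiv ^^ (N + 1 - p)) (hat 0 m)"
      using True N by (auto simp: branch_def hat_bracket_def nat_diff_distrib nat_add_distrib)
    then show ?thesis using derivs[of "N + 1 - p" i] p by simp
  next
    case p: False
    then have "branch p m = hat (p - (N + 1)) m"
      using True N by (auto simp: branch_def hat_bracket_def intro!: arg_cong[where f = "\<lambda>n. hat n m"])
    then show ?thesis using hat_local_series[OF hat[OF True] True, of "p - (N + 1)" i] p N by simp
  qed
qed

section \<open>The primitives and system (F)\<close>

lemma branch_holomorphic: "(\<lambda>z. branch p m z $ i) holomorphic_on P"
  using branch_local_series unfolding local_series_def by blast

lemma has_field_derivative_branch: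
  assumes "z \<in> P"
  shows "((\<lambda>z. branch (Suc p) m z $ i) has_field_derivative branch p m z $ i) (at z)"
proof -
  have "local_series lam \<eta> m (expo A1 m) (\<lambda>l. coef A1 F m p l $ i) (deriv (\<lambda>z. branch (Suc p) m z $ i))"
    by (rule local_series_deriv[OF branch_local_series coef_euler])
  from local_series_unique[OF this branch_local_series assms]
  have "deriv (\<lambda>z. branch (Suc p) m z $ i) z = branch p m z $ i" .
  moreover have "(\<lambda>z. branch (Suc p) m z $ i) field_differentiable at z"
    using branch_holomorphic open_cut_plane assms holomorphic_on_imp_differentiable_at by blast
  ultimately show ?thesis
    using field_differentiable_derivI by fastforce
qed

text \<open>Both sides have the same coefficients at the pole. For \<open>\<lambda>'\<^sub>m\<close>
  in \<nat> this is the identity of \<open>\<Psi>\<^sub>m\<close> with the derivative of order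
  \<open>NN A1 m + 1\<close> of the hatted function.\<close>

lemma Psi_eq_branch:
  assumes "z \<in> P"
  shows "Psi m z = branch 0 m z"
proof -
  have "local_series lam \<eta> m (expo A1 m) (\<lambda>l. coef A1 F m 0 l $ i) (\<lambda>z. Psi m z $ i)" for i
  proof (cases "A1 $ m $ m \<in> \<nat>")
    case False
    then have "is_Psi_prim lam A1 \<eta> F 0 m (Psi m)"
      using Psi[of m] by (simp add: is_Psi_def is_Psi_prim_def Psi_term_def[abs_def])
    then show ?thesis using False by (rule prim_local_series)
  next
    case True
    show ?thesis
    proof (rule local_series_of_terms)
      show "continues_series P (lam m) (Psi_term lam A1 \<eta> F m) (Psi m)"
        using Psi[of m] by (simp add: is_Psi_def)
    next
      fix z S
      assume S: "(\<lambda>l. Psi_term lam A1 \<eta> F m l z $ i) sums S"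
      have int: "A1 $ m $ m \<in> \<int>" using True Nats_subset_Ints by blast
      have N: "NN A1 m \<ge> 0"
        using True by (auto simp: NN_def elim!: Nats_cases)
      have "Psi_term lam A1 \<eta> F m l z $ i = coef A1 F m 0 l $ i * (z - lam m) ^ l" for l
      proof -
        have "nat (int l + NN A1 m + 1) = nat (NN A1 m) + l + 1" "\<not> int l + NN A1 m + 1 < 0"
          using N by linarith+
        then show ?thesis
          using True int by (simp add: Psi_term_def coef_def int_fcol_def)
      qed
      with S show "(\<lambda>l. coef A1 F m 0 l $ i * (z - lam m) ^ l) sums
          (S * cut_pow \<eta> (z - lam m) (- expo A1 m))"
        using int by (simp add: expo_def)
    qed
  qed
  from local_series_unique[OF this branch_local_series assms] show ?thesis
    by (simp add: vec_eq_iff)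
qed

text \<open>System (F) integrated once. That no constant of integration appears is seen by comparing
  the series of both sides at \<open>\<lambda>\<^sub>m\<close>, which is what
  \<open>coef_ode\<close> does.\<close>

lemma branch_relation:
  assumes z: "z \<in> P"
  shows "(lam i - z) * branch 0 m z $ i = (\<Sum>j\<in>UNIV. A1 $ i $ j * branch 1 m z $ j)"
proof -
  let ?\<beta> = "expo A1 m"
  define a where "a = (\<lambda>l. coef A1 F m 0 l $ i)"
  have a0: "local_series lam \<eta> m ?\<beta> a (\<lambda>z. branch 0 m z $ i)"
    unfolding a_def by (rule branch_local_series)
  have mid: "local_series lam \<eta> m ?\<beta> (\<lambda>l. \<Sum>j\<in>UNIV. A1 $ i $ j * coef A1 F m 1 l $ j)
      (\<lambda>z. \<Sum>j\<in>UNIV. A1 $ i $ j * branch 1 m z $ j)"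
  proof -
    have "\<exists>e>0. \<forall>z\<in>P \<inter> ball (lam m) e. (\<lambda>l. coef A1 F m 1 l $ j * (z - lam m) ^ l) sums
        (branch 1 m z $ j * cut_pow \<eta> (z - lam m) (- ?\<beta>))" for j
      using branch_local_series[of m 1 j] unfolding local_series_def by blast
    then have "\<forall>j. \<exists>e>0. \<forall>z\<in>P \<inter> ball (lam m) e. (\<lambda>l. coef A1 F m 1 l $ j * (z - lam m) ^ l) sums
        (branch 1 m z $ j * cut_pow \<eta> (z - lam m) (- ?\<beta>))" ..
    from choice[OF this] obtain e where e: "\<And>j. e j > 0"
      "\<And>j z. z \<in> P \<inter> ball (lam m) (e j) \<Longrightarrow> (\<lambda>l. coef A1 F m 1 l $ j * (z - lam m) ^ l) sums
        (branch 1 m z $ j * cut_pow \<eta> (z - lam m) (- ?\<beta>))" by blast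
    define d where "d = Min (range e)"
    have d: "d > 0" "\<And>j. d \<le> e j" using e(1) by (auto simp: d_def)
    have "(\<lambda>l. (\<Sum>j\<in>UNIV. A1 $ i $ j * coef A1 F m 1 l $ j) * (z - lam m) ^ l) sums
        ((\<Sum>j\<in>UNIV. A1 $ i $ j * branch 1 m z $ j) * cut_pow \<eta> (z - lam m) (- ?\<beta>))"
      if z: "z \<in> P \<inter> ball (lam m) d" for z
    proof -
      have "(\<lambda>l. \<Sum>j\<in>UNIV. A1 $ i $ j * (coef A1 F m 1 l $ j * (z - lam m) ^ l)) sums
        (\<Sum>j\<in>UNIV. A1 $ i $ j * (branch 1 m z $ j * cut_pow \<eta> (z - lam m) (- ?\<beta>)))"
      proof (intro sums_sum sums_mult e(2))
        fix j show "z \<in> P \<inter> ball (lam m) (e j)" using z d(2)[of j] by auto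
      qed
      then show ?thesis by (simp add: sum_distrib_right mult.assoc)
    qed
    moreover have "(\<lambda>z. \<Sum>j\<in>UNIV. A1 $ i $ j * branch 1 m z $ j) holomorphic_on P"
      by (intro holomorphic_intros branch_holomorphic)
    ultimately show ?thesis unfolding local_series_def using d(1) by blast
  qed
  have left: "local_series lam \<eta> m ?\<beta> (\<lambda>l. \<Sum>j\<in>UNIV. A1 $ i $ j * coef A1 F m 1 l $ j)
      (\<lambda>z. (lam i - z) * branch 0 m z $ i)"
  proof -
    obtain e where e: "e > 0" "\<And>z. z \<in> P \<inter> ball (lam m) e \<Longrightarrow>
        (\<lambda>l. a l * (z - lam m) ^ l) sums (branch 0 m z $ i * cut_pow \<eta> (z - lam m) (- ?\<beta>))"
      using a0 unfolding local_series_def by blast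
    have "(\<lambda>l. (\<Sum>j\<in>UNIV. A1 $ i $ j * coef A1 F m 1 l $ j) * (z - lam m) ^ l) sums
        (((lam i - z) * branch 0 m z $ i) * cut_pow \<eta> (z - lam m) (- ?\<beta>))"
      if z: "z \<in> P \<inter> ball (lam m) e" for z
    proof -
      let ?x = "z - lam m" and ?S = "branch 0 m z $ i * cut_pow \<eta> (z - lam m) (- ?\<beta>)"
      have "(\<lambda>l. (if Suc l = 0 then 0 else a (Suc l - 1)) * ?x ^ Suc l) sums (?x * ?S)"
        using sums_mult[OF e(2)[OF z], of ?x] by (simp add: mult_ac)
      then have s1: "(\<lambda>l. (if l = 0 then 0 else a (l - 1)) * ?x ^ l) sums (?x * ?S)"
        by (subst (asm) sums_Suc_iff) simp
      have "(\<lambda>l. (lam i - lam m) * (a l * ?x ^ l) - (if l = 0 then 0 else a (l - 1)) * ?x ^ l) sums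
          ((lam i - lam m) * ?S - ?x * ?S)"
        by (intro sums_diff sums_mult e(2) z s1)
      moreover have "(lam i - lam m) * (a l * ?x ^ l) - (if l = 0 then 0 else a (l - 1)) * ?x ^ l
          = (\<Sum>j\<in>UNIV. A1 $ i $ j * coef A1 F m 1 l $ j) * ?x ^ l" for l
        unfolding coef_ode[OF formal, of i m l, symmetric] a_def by (simp add: left_diff_distrib)
      moreover have "(lam i - lam m) * ?S - ?x * ?S
          = ((lam i - z) * branch 0 m z $ i) * cut_pow \<eta> (z - lam m) (- ?\<beta>)"
        by (simp add: algebra_simps)
      ultimately show ?thesis by simp
    qed
    moreover have "(\<lambda>z. (lam i - z) * branch 0 m z $ i) holomorphic_on P"
      by (intro holomorphic_intros branch_holomorphic)
    ultimately show ?thesis unfolding local_series_def using e(1) by blast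
  qed
  show ?thesis by (rule local_series_unique[OF left mid z])
qed

text \<open>Differentiating \<open>branch_relation\<close> and solving for the derivative; the
  identity matrix next to \<open>A1\<close> comes from the derivative of the factor
  \<open>lam i - z\<close>.\<close>

lemma branch_ode:
  assumes z: "z \<in> P"
  shows "((\<lambda>z. branch 0 m z $ i) has_field_derivative
    (\<Sum>j\<in>UNIV. (A1 + mat 1) $ i $ j / (lam i - z) * branch 0 m z $ j)) (at z)"
proof -
  let ?f = "\<lambda>z. branch 0 m z $ i"
  have ne: "lam i \<noteq> z" using z pole_notin_P by blast
  have "?f field_differentiable at z"
    using branch_holomorphic open_cut_plane z holomorphic_on_imp_differentiable_at by blast
  then obtain D where D: "(?f has_field_derivative D) (at z)"
    unfolding field_differentiable_def by blast
  have "((\<lambda>z. (lam i - z) * ?f z) has_field_derivative (lam i - z) * D - ?f z) (at z)"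
    using D by (auto intro!: derivative_eq_intros)
  moreover have "((\<lambda>z. \<Sum>j\<in>UNIV. A1 $ i $ j * branch 1 m z $ j) has_field_derivative
      (\<Sum>j\<in>UNIV. A1 $ i $ j * branch 0 m z $ j)) (at z)"
    using has_field_derivative_branch[OF z, of 0 m] by (intro DERIV_sum DERIV_cmult) simp
  then have "((\<lambda>z. (lam i - z) * ?f z) has_field_derivative
      (\<Sum>j\<in>UNIV. A1 $ i $ j * branch 0 m z $ j)) (at z)"
    by (rule has_field_derivative_transform_within_open[where S = P])
      (use z open_cut_plane branch_relation in auto)
  ultimately have "(lam i - z) * D - ?f z = (\<Sum>j\<in>UNIV. A1 $ i $ j * branch 0 m z $ j)"
    by (rule DERIV_unique)
  moreover have "(\<Sum>j\<in>UNIV. (A1 + mat 1) $ i $ j * branch 0 m z $ j)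
      = (\<Sum>j\<in>UNIV. A1 $ i $ j * branch 0 m z $ j) + ?f z"
    by (simp add: mat_def distrib_right sum.distrib if_distrib[of "\<lambda>x. x * _"] cong: if_cong)
  ultimately have "(\<Sum>j\<in>UNIV. (A1 + mat 1) $ i $ j * branch 0 m z $ j) = (lam i - z) * D"
    by (simp only: diff_eq_eq)
  then have "(\<Sum>j\<in>UNIV. (A1 + mat 1) $ i $ j * branch 0 m z $ j) / (lam i - z) = D"
    using ne by simp
  then show ?thesis using D by (simp add: sum_divide_distrib)
qed

end

section \<open>Lifts and monodromy\<close>

lemma eq_of_same_derivative:
  fixes f g :: "complex \<Rightarrow> complex"
  assumes "convex S" "w0 \<in> S" "w \<in> S" "f w0 = g w0"
    and "\<And>w. w \<in> S \<Longrightarrow> (f has_field_derivative d w) (at w)"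
    and "\<And>w. w \<in> S \<Longrightarrow> (g has_field_derivative d w) (at w)"
  shows "f w = g w"
proof -
  have "((\<lambda>w. f w - g w) has_field_derivative 0) (at x within S)" if "x \<in> S" for x
    using DERIV_diff[OF assms(5,6)[OF that]] has_field_derivative_at_within by simp
  from has_field_derivative_zero_constant[OF assms(1) this]
  obtain C where C: "\<And>x. x \<in> S \<Longrightarrow> f x - g x = C" by blast
  from C[OF assms(2)] C[OF assms(3)] assms(4) show ?thesis by simp
qed

lemma powser_holomorphic:
  fixes c :: "nat \<Rightarrow> complex"
  assumes "\<And>x. norm x < e \<Longrightarrow> summable (\<lambda>l. c l * x ^ l)"
  shows "(\<lambda>x. \<Sum>l. c l * x ^ l) holomorphic_on ball 0 e"
proof -
  have "((\<lambda>x. \<Sum>l. c l * x ^ l) has_field_derivative (\<Sum>l. diffs c l * x ^ l)) (at x)" if "norm x < e" for x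
    by (rule termdiffs_strong'[OF assms that])
  then show ?thesis
    by (intro holomorphic_onI) (auto simp: field_differentiable_def intro: has_field_derivative_at_within)
qed

lemma norm_exp_less: "norm (exp w) < e" if "Re w < ln e" "e > 0"
proof -
  have "exp (Re w) < exp (ln e)" using that(1) by (simp only: exp_less_mono)
  then show ?thesis using that(2) by simp
qed

lemma open_convex_half_plane: "open {w. Re w < R}" "convex {w. Re w < R}"
  by (rule open_halfspace_Re_lt, rule convex_halfspace_Re_lt)

section \<open>Lifting the primitives to the half-plane\<close>

context connection_system
begin

text \<open>Under \<open>z = lam j + exp w\<close> the system has coefficients holomorphic on the
  whole half-plane, so the solution of the initial value problem extends the pull-back of
  \<open>\<Psi>\<^sub>k\<close>. The higher levels follow by integration against
  \<open>exp w\<close>, the derivative of the substitution.\<close>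

lemma branch_lift:
  assumes r: "r > 0" and disj: "\<And>i. i \<noteq> j \<Longrightarrow> ball (lam j) r \<inter> cut lam \<eta> i = {}"
  shows "\<exists>\<Phi> :: nat \<Rightarrow> 'n \<Rightarrow> complex \<Rightarrow> complex. \<forall>p i.
    \<Phi> p i holomorphic_on {w. Re w < ln r} \<and>
    (\<forall>w\<in>strip \<eta> (ln r). \<Phi> p i w = branch p k (lam j + exp w) $ i) \<and>
    (\<forall>w\<in>{w. Re w < ln r}. (\<Phi> (Suc p) i has_field_derivative exp w * \<Phi> p i w) (at w))"
proof -
  let ?U = "{w. Re w < ln r}" and ?S = "strip \<eta> (ln r)"
  note U = open_convex_half_plane[of "ln r"]
  have SU: "?S \<subseteq> ?U" by (auto simp: strip_def)
  obtain w0 where w0: "w0 \<in> ?S" using strip_nonempty by blast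
  have inP: "lam j + exp w \<in> P" if "w \<in> ?S" for w
    using exp_strip_mem_cut_plane[OF that r disj] by blast
  have chain: "((\<lambda>w. f (lam j + exp w)) has_field_derivative exp w * D) (at w)"
    if "(f has_field_derivative D) (at (lam j + exp w))" for f D w
  proof -
    have "((\<lambda>w. lam j + exp w) has_field_derivative exp w) (at w)"
      by (auto intro!: derivative_eq_intros)
    from DERIV_chain2[of f D "\<lambda>w. lam j + exp w" w "exp w", OF that this] show ?thesis
      by (simp add: mult.commute)
  qed
  \<comment> \<open>The pulled-back coefficient matrix. Its denominators do not vanish: for
    \<open>i = j\<close> they are \<open>- exp w\<close>, and the other poles lie outside the disc
    of radius \<open>r\<close>.\<close>
  define M where "M = (\<lambda>w i l. exp w * ((A1 + mat 1) $ i $ l / (lam i - (lam j + exp w))))"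
  have nz: "lam i - (lam j + exp w) \<noteq> 0" if "w \<in> ?U" for i w
  proof (cases "i = j")
    case False
    have "lam i \<in> cut lam \<eta> i" by (simp add: mem_cut_iff)
    then have "lam i \<notin> ball (lam j) r" using disj[OF False] by blast
    moreover have "lam j + exp w \<in> ball (lam j) r"
      using norm_exp_less[of w r] that r by (simp add: dist_norm)
    ultimately show ?thesis by auto
  qed simp
  have M: "(\<lambda>w. M w i l) holomorphic_on ?U" for i l
    unfolding M_def by (intro holomorphic_intros nz)
  have w0U: "w0 \<in> ?U" using w0 SU by blast
  obtain Y where Y0: "\<And>i. Y i w0 = branch 0 k (lam j + exp w0) $ i"
    and Y: "\<And>w i. w \<in> ?U \<Longrightarrow> (Y i has_field_derivative (\<Sum>l\<in>UNIV. M w i l * Y l w)) (at w)"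
    using linear_ode_exists[where M = M and v = "\<lambda>i. branch 0 k (lam j + exp w0) $ i", OF U(2,1) w0U M] by blast
  have Yeq: "Y i w = branch 0 k (lam j + exp w) $ i" if "w \<in> ?S" for i w
  proof (rule linear_ode_unique[where U = ?S and M = M and ?w0.0 = w0
        and Z = "\<lambda>i w. branch 0 k (lam j + exp w) $ i"])
    show "(\<lambda>w. M w i l) holomorphic_on ?S" for i l
      using M SU by (rule holomorphic_on_subset)
    show "(Y i has_field_derivative (\<Sum>l\<in>UNIV. M w i l * Y l w)) (at w)" if "w \<in> ?S" for w i
      using Y that SU by blast
    show "((\<lambda>w. branch 0 k (lam j + exp w) $ i) has_field_derivative
        (\<Sum>l\<in>UNIV. M w i l * branch 0 k (lam j + exp w) $ l)) (at w)" if "w \<in> ?S" for w i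
      using chain[OF branch_ode[OF inP[OF that], of k i]]
      by (simp only: M_def sum_distrib_left mult.assoc)
  qed (use that w0 Y0 convex_strip in auto)
  define good where "good = (\<lambda>p (\<phi> :: 'n \<Rightarrow> complex \<Rightarrow> complex). \<forall>i. \<phi> i holomorphic_on ?U \<and>
      (\<forall>w\<in>?S. \<phi> i w = branch p k (lam j + exp w) $ i))"
  have "\<exists>\<phi>. good 0 \<phi>"
  proof -
    have "Y i holomorphic_on ?U" for i
      using Y by (intro holomorphic_onI) (auto simp: field_differentiable_def intro: has_field_derivative_at_within)
    then show ?thesis using Yeq unfolding good_def by blast
  qed
  moreover have "\<exists>\<psi>. good (Suc p) \<psi> \<and> (\<forall>i. \<forall>w\<in>?U. (\<psi> i has_field_derivative exp w * \<phi> i w) (at w))"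
    if \<phi>: "good p \<phi>" for p \<phi>
  proof -
    have "\<exists>g. g w0 = 0 \<and> (\<forall>w\<in>?U. (g has_field_derivative exp w * \<phi> i w) (at w))" for i
    proof -
      have "(\<lambda>w. exp w * \<phi> i w) holomorphic_on ?U"
        using \<phi> by (intro holomorphic_intros) (simp add: good_def)
      then obtain g where "g w0 = 0" "\<And>w. w \<in> ?U \<Longrightarrow> (g has_field_derivative exp w * \<phi> i w) (at w)"
        using primitive_vanishing_at[OF U(2,1)] by blast
      then show ?thesis by blast
    qed
    then have "\<forall>i. \<exists>g. g w0 = 0 \<and> (\<forall>w\<in>?U. (g has_field_derivative exp w * \<phi> i w) (at w))" ..
    from choice[OF this] obtain g where g: "\<And>i. g i w0 = 0"
      "\<And>i w. w \<in> ?U \<Longrightarrow> (g i has_field_derivative exp w * \<phi> i w) (at w)" by blast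
    \<comment> \<open>The constant of integration is chosen so that the lift has the right value at
      \<open>w0\<close>; equality on the strip then follows from equality of derivatives.\<close>
    define \<psi> where "\<psi> = (\<lambda>i w. branch (Suc p) k (lam j + exp w0) $ i + g i w)"
    have der: "(\<psi> i has_field_derivative exp w * \<phi> i w) (at w)" if "w \<in> ?U" for i w
      unfolding \<psi>_def using DERIV_add[OF DERIV_const g(2)[OF that]] by simp
    have "\<psi> i w = branch (Suc p) k (lam j + exp w) $ i" if w: "w \<in> ?S" for i w
    proof (rule eq_of_same_derivative[OF convex_strip w0 w])
      show "\<psi> i w0 = branch (Suc p) k (lam j + exp w0) $ i" by (simp add: \<psi>_def g)
      show "(\<psi> i has_field_derivative exp v * \<phi> i v) (at v)" if "v \<in> ?S" for v
        using der that SU by blast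
      show "((\<lambda>w. branch (Suc p) k (lam j + exp w) $ i) has_field_derivative exp v * \<phi> i v) (at v)"
        if v: "v \<in> ?S" for v
        using chain[OF has_field_derivative_branch[OF inP[OF v], of p k i]] \<phi> v by (simp add: good_def)
    qed
    moreover have "\<psi> i holomorphic_on ?U" for i
      using der by (intro holomorphic_onI) (auto simp: field_differentiable_def intro: has_field_derivative_at_within)
    ultimately show ?thesis using der unfolding good_def by blast
  qed
  \<comment> \<open>Each lift is a primitive of the one chosen before it, so the whole sequence
    needs dependent choice.\<close>
  ultimately have "\<exists>\<Phi>. \<forall>p. good p (\<Phi> p) \<and>
      (\<forall>i. \<forall>w\<in>?U. (\<Phi> (Suc p) i has_field_derivative exp w * \<Phi> p i w) (at w))"
    by (rule dependent_nat_choice)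
  then show ?thesis unfolding good_def by blast
qed

section \<open>The multivalued part at a pole\<close>

definition ser :: "'n \<Rightarrow> 'n \<Rightarrow> nat \<Rightarrow> complex \<Rightarrow> complex" where
  "ser m i p x = (\<Sum>l. coef A1 F m p l $ i * x ^ l)"

text \<open>At \<open>p = 0\<close> and for \<open>\<lambda>'\<^sub>m\<close> in \<nat> these are
  the polar terms in the definition of the singular solution. Each further level integrates them
  termwise and drops the simple pole. The truncation by \<open>nat\<close> makes the sum empty once
  no pole is left, and always for negative integers.\<close>

definition polar :: "'n \<Rightarrow> 'n \<Rightarrow> nat \<Rightarrow> complex \<Rightarrow> complex" where
  "polar m i p x = (-1) ^ p * (\<Sum>l<nat (NN A1 m + 1 - int p).
     fact (nat (NN A1 m + 1 - int p) - 1 - l) * fcol F m l $ i / x ^ (nat (NN A1 m + 1 - int p) - l))"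

text \<open>In the coordinate \<open>w = ln (\<lambda> - \<lambda>\<^sub>m)\<close>, the multivalued part of the \<open>p\<close>-th primitive of the
  singular solution. The polar terms are those for which \<open>singular (p + 1)\<close> is a primitive of
  \<open>singular p\<close> up to a regular function: the logarithms created by integrating \<open>1 / (\<lambda> - \<lambda>\<^sub>m)\<close>
  cancel.\<close>

definition singular :: "'n \<Rightarrow> 'n \<Rightarrow> nat \<Rightarrow> complex \<Rightarrow> complex" where
  "singular m i p w = (if A1 $ m $ m \<in> \<int> then w * ser m i p (exp w) + polar m i p (exp w)
     else exp (expo A1 m * w) * ser m i p (exp w))"

lemma ser_radius:
  "\<exists>e>0. (\<forall>x. norm x < e \<longrightarrow> summable (\<lambda>l. coef A1 F m p l $ i * x ^ l)) \<and>
    (\<forall>z\<in>P \<inter> ball (lam m) e.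
      branch p m z $ i = cut_pow \<eta> (z - lam m) (expo A1 m) * ser m i p (z - lam m))"
proof -
  obtain e where "e > 0" "\<And>x. norm x < e \<Longrightarrow> summable (\<lambda>l. coef A1 F m p l $ i * x ^ l)"
    "\<And>z. z \<in> P \<Longrightarrow> z \<in> ball (lam m) e \<Longrightarrow>
      branch p m z $ i = cut_pow \<eta> (z - lam m) (expo A1 m) * (\<Sum>l. coef A1 F m p l $ i * (z - lam m) ^ l)"
    using local_seriesE[OF branch_local_series[of m p i]] by blast
  then show ?thesis unfolding ser_def by blast
qed

lemma ser_euler:
  assumes conv: "\<And>x. norm x < e \<Longrightarrow> summable (\<lambda>l. coef A1 F m (Suc p) l $ i * x ^ l)" and x: "norm x < e"
  obtains D where "(ser m i (Suc p) has_field_derivative D) (at x)"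
    "expo A1 m * ser m i (Suc p) x + x * D = x * ser m i p x"
  using that[OF _ powser_euler_relation(2)[OF conv coef_euler x, folded ser_def]]
    termdiffs_strong'[OF conv x, folded ser_def] by simp

text \<open>Differentiation restores all polar terms of level \<open>p\<close> except the simple
  pole, which has no preimage among the polar terms. Its coefficient is the constant term of the
  series at level \<open>Suc p\<close>, and there the derivative of the logarithm compensates
  it.\<close>

lemma has_field_derivative_polar:
  assumes int: "A1 $ m $ m \<in> \<int>" and x: "x \<noteq> 0"
  shows "(polar m i (Suc p) has_field_derivative polar m i p x - coef A1 F m (Suc p) 0 $ i / x) (at x)"
proof (cases "nat (NN A1 m + 1 - int p)")
  case 0
  \<comment> \<open>Without polar terms at level \<open>p\<close> the subtracted coefficient is zero
    too, because its column index \<open>NN A1 m - int p\<close> is negative.\<close>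
  then have s: "nat (NN A1 m + 1 - int (Suc p)) = 0" "NN A1 m - int p < 0" by linarith+
  then have "coef A1 F m (Suc p) 0 $ i = 0"
    using int by (simp add: coef_def int_fcol_def)
  moreover have "polar m i (Suc p) = (\<lambda>_. 0)"
    by (simp only: polar_def s fun_eq_iff) simp
  moreover have "polar m i p x = 0" by (simp add: polar_def 0)
  ultimately show ?thesis by simp
next
  case (Suc s)
  then have s: "nat (NN A1 m + 1 - int (Suc p)) = s" "NN A1 m + 1 - int (Suc p) = int s" by linarith+
  let ?f = "\<lambda>l. fcol F m l $ i"
  have c: "coef A1 F m (Suc p) 0 $ i = (-1) ^ p * ?f s"
    using int s(2) unfolding coef_def by (simp only: if_True) (simp add: int_fcol_of_nat algebra_simps)
  have "((\<lambda>x. fact (s - 1 - l) * ?f l / x ^ (s - l)) has_field_derivative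
      - (fact (s - l) * ?f l / x ^ (Suc s - l))) (at x)" if "l < s" for l
  proof -
    define n where "n = s - 1 - l"
    have n: "s - l = Suc n" "s - 1 - l = n" "Suc s - l = Suc (Suc n)"
      using that by (auto simp: n_def)
    have "((\<lambda>x. fact n * ?f l * inverse (x ^ Suc n)) has_field_derivative
        fact n * ?f l * (- (inverse (x ^ Suc n) * ((1 + of_nat n) * (1 * x ^ n)) * inverse (x ^ Suc n)))) (at x)"
      by (intro DERIV_cmult DERIV_inverse' DERIV_power_Suc DERIV_ident) (simp add: x)
    moreover have "fact n * ?f l * (- (inverse (x ^ Suc n) * ((1 + of_nat n) * (1 * x ^ n)) * inverse (x ^ Suc n)))
        = - (fact (Suc n) * ?f l / x ^ Suc (Suc n))"
      using x by (simp add: field_simps)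
    ultimately show ?thesis unfolding n by (simp only: divide_inverse)
  qed
  then have "((\<lambda>x. (-1) ^ Suc p * (\<Sum>l<s. fact (s - 1 - l) * ?f l / x ^ (s - l))) has_field_derivative
      (-1) ^ Suc p * (\<Sum>l<s. - (fact (s - l) * ?f l / x ^ (Suc s - l)))) (at x)"
    by (intro DERIV_cmult DERIV_sum) simp
  moreover have "(-1) ^ Suc p * (\<Sum>l<s. - (fact (s - l) * ?f l / x ^ (Suc s - l)))
      = polar m i p x - coef A1 F m (Suc p) 0 $ i / x"
    unfolding polar_def Suc c by (simp add: sum_negf distrib_left)
  ultimately show ?thesis unfolding polar_def s(1) by (simp only:)
qed

text \<open>In the integer case, differentiating the factor \<open>w\<close> produces the
  undifferentiated series. Its constant term cancels against the simple pole missing from the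
  derivative of \<open>polar\<close>, and the remainder is \<open>exp w * B (exp w)\<close>, hence
  regular at the pole. In the other case the relation is exact and \<open>B\<close> is zero.\<close>

lemma has_field_derivative_singular:
  assumes conv: "\<And>x. norm x < e \<Longrightarrow> summable (\<lambda>l. coef A1 F m (Suc p) l $ i * x ^ l)" and e: "e > 0"
  shows "\<exists>B. B holomorphic_on ball 0 e \<and> (\<forall>w. Re w < ln e \<longrightarrow>
      (singular m i (Suc p) has_field_derivative exp w * (singular m i p w + B (exp w))) (at w))"
proof (cases "A1 $ m $ m \<in> \<int>")
  case False
  have "(singular m i (Suc p) has_field_derivative exp w * (singular m i p w + 0)) (at w)" if w: "Re w < ln e" for w
  proof -
    let ?b = "expo A1 m"
    obtain D where D: "(ser m i (Suc p) has_field_derivative D) (at (exp w))"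
        "?b * ser m i (Suc p) (exp w) + exp w * D = exp w * ser m i p (exp w)"
      using ser_euler[OF conv norm_exp_less[OF w e]] by blast
    have "((\<lambda>w. ser m i (Suc p) (exp w)) has_field_derivative D * exp w) (at w)"
      using DERIV_chain2[OF D(1) DERIV_exp] .
    then have "((\<lambda>w. exp (?b * w) * ser m i (Suc p) (exp w)) has_field_derivative
        exp (?b * w) * ?b * ser m i (Suc p) (exp w) + D * exp w * exp (?b * w)) (at w)"
      by (auto intro!: derivative_eq_intros)
    moreover have "exp (?b * w) * ?b * ser m i (Suc p) (exp w) + D * exp w * exp (?b * w)
        = exp (?b * w) * (?b * ser m i (Suc p) (exp w) + exp w * D)"
      by (simp add: algebra_simps)
    moreover have "singular m i (Suc p) = (\<lambda>w. exp (?b * w) * ser m i (Suc p) (exp w))"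
      using False by (simp add: singular_def fun_eq_iff)
    ultimately show ?thesis
      unfolding D(2) using False by (simp add: singular_def mult_ac)
  qed
  then show ?thesis by (intro exI[of _ "\<lambda>_. 0"]) simp
next
  case True
  have b0: "expo A1 m = 0" using True by (simp add: expo_def)
  let ?a = "\<lambda>l. coef A1 F m (Suc p) l $ i"
  define B where "B = (\<lambda>x. \<Sum>l. ?a (Suc l) * x ^ l)"
  have head: "summable (\<lambda>l. ?a (Suc l) * x ^ l)" "ser m i (Suc p) x = ?a 0 + x * B x" if "norm x < e" for x
    using powser_split_head[OF conv[OF that]] unfolding ser_def B_def by (simp_all add: mult.commute)
  have "B holomorphic_on ball 0 e"
    unfolding B_def by (rule powser_holomorphic) (rule head(1))
  moreover have "(singular m i (Suc p) has_field_derivative exp w * (singular m i p w + B (exp w))) (at w)"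
    if w: "Re w < ln e" for w
  proof -
    have x: "norm (exp w) < e" using norm_exp_less[OF w e] .
    obtain D where D: "(ser m i (Suc p) has_field_derivative D) (at (exp w))"
        "exp w * D = exp w * ser m i p (exp w)"
      using ser_euler[OF conv x] b0 by auto
    have d1: "((\<lambda>w. ser m i (Suc p) (exp w)) has_field_derivative D * exp w) (at w)"
      using DERIV_chain2[OF D(1) DERIV_exp] .
    have d2: "((\<lambda>w. polar m i (Suc p) (exp w)) has_field_derivative
        (polar m i p (exp w) - ?a 0 / exp w) * exp w) (at w)"
      using DERIV_chain2[OF has_field_derivative_polar[OF True exp_not_eq_zero] DERIV_exp] .
    have "((\<lambda>w. w * ser m i (Suc p) (exp w) + polar m i (Suc p) (exp w)) has_field_derivative
        1 * ser m i (Suc p) (exp w) + D * exp w * w + (polar m i p (exp w) - ?a 0 / exp w) * exp w) (at w)"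
      by (intro DERIV_add DERIV_mult DERIV_ident d1 d2)
    moreover have "1 * ser m i (Suc p) (exp w) + D * exp w * w + (polar m i p (exp w) - ?a 0 / exp w) * exp w
        = exp w * (singular m i p w + B (exp w))"
    proof -
      have "D = ser m i p (exp w)" using D(2) by simp
      then show ?thesis
        using True head(2)[OF x] by (simp add: singular_def algebra_simps)
    qed
    moreover have "singular m i (Suc p) = (\<lambda>w. w * ser m i (Suc p) (exp w) + polar m i (Suc p) (exp w))"
      using True by (simp add: singular_def fun_eq_iff)
    ultimately show ?thesis by simp
  qed
  ultimately show ?thesis by blast
qed

lemma singular_holomorphic:
  assumes conv: "\<And>x. norm x < e \<Longrightarrow> summable (\<lambda>l. coef A1 F m p l $ i * x ^ l)" and e: "e > 0"
  shows "singular m i p holomorphic_on {w. Re w < ln e}"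
proof -
  have "ser m i p holomorphic_on ball 0 e"
    unfolding ser_def using conv by (rule powser_holomorphic)
  then have "(ser m i p \<circ> exp) holomorphic_on {w. Re w < ln e}"
    by (rule holomorphic_on_compose_gen[rotated])
      (use norm_exp_less[OF _ e] in \<open>auto intro!: holomorphic_intros\<close>)
  then have s: "(\<lambda>w. ser m i p (exp w)) holomorphic_on {w. Re w < ln e}"
    by (simp add: o_def)
  have p: "(\<lambda>w. polar m i p (exp w)) holomorphic_on {w. Re w < ln e}"
    unfolding polar_def by (intro holomorphic_intros) auto
  show ?thesis
  proof (cases "A1 $ m $ m \<in> \<int>")
    case True
    then have "singular m i p = (\<lambda>w. w * ser m i p (exp w) + polar m i p (exp w))"
      by (simp add: singular_def fun_eq_iff)
    then show ?thesis using s p by (simp only:) (intro holomorphic_intros)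
  next
    case False
    then have "singular m i p = (\<lambda>w. exp (expo A1 m * w) * ser m i p (exp w))"
      by (simp add: singular_def fun_eq_iff)
    then show ?thesis using s by (simp only:) (intro holomorphic_intros)
  qed
qed

text \<open>The translation leaves every function of \<open>exp w\<close> unchanged. Only the factor
  \<open>w\<close> grows, by 2 pi i, or the power is multiplied by an exponential, in which the
  summand -1 of the exponent contributes nothing; both give \<open>alpha A1 m\<close>.\<close>

lemma singular_monodromy:
  "singular m i p (w + 2 * of_real pi * \<i>) - singular m i p w
     = alpha A1 m * (exp (expo A1 m * w) * ser m i p (exp w))"
proof -
  have e: "exp (w + 2 * of_real pi * \<i>) = exp w" by (simp add: exp_add)
  show ?thesis
  proof (cases "A1 $ m $ m \<in> \<int>")
    case True
    then show ?thesis unfolding singular_def e by (simp add: expo_def alpha_def algebra_simps)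
  next
    case False
    have "expo A1 m * (w + 2 * of_real pi * \<i>)
        = expo A1 m * w + (- (2 * of_real pi * \<i> * A1 $ m $ m) - 2 * of_real pi * \<i>)"
      using False by (simp add: expo_def algebra_simps)
    then have "exp (expo A1 m * (w + 2 * of_real pi * \<i>))
        = exp (expo A1 m * w) * exp (- (2 * of_real pi * \<i> * A1 $ m $ m))"
      by (simp only: exp_add exp_diff) simp
    then show ?thesis using False unfolding singular_def e by (simp add: alpha_def algebra_simps)
  qed
qed

end

section \<open>Local form at a pole and the effect of a loop\<close>

locale connection_coefficients = connection_system lam \<eta> A1 F Psi Psi_prim hat
  for lam :: "'n::finite \<Rightarrow> complex" and \<eta> A1 F Psi Psi_prim hat +
  fixes Psi_sing :: "'n \<Rightarrow> complex \<Rightarrow> complex^'n" and c :: "'n \<Rightarrow> 'n \<Rightarrow> complex"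
  assumes sing: "\<And>m. is_Psi_sing lam A1 \<eta> F m (Psi m) (Psi_sing m)"
    and conn: "connection_coeffs lam A1 \<eta> Psi Psi_sing c"
begin

text \<open>Nonvanishing of the connection coefficient excludes the singular solution that is zero
  by convention. In the remaining cases the definition of the singular solution prescribes exactly
  this multivalued part.\<close>

lemma Psi_sing_local_form:
  assumes cj: "c j k \<noteq> 0"
  shows "\<exists>R e. R analytic_on {lam j} \<and> 0 < e \<and> (\<forall>z\<in>P \<inter> ball (lam j) e.
      Psi_sing j z $ i = singular j i 0 (cut_log \<eta> (z - lam j)) + R z)"
proof -
  obtain e0 where e0: "e0 > 0" and b: "\<And>z. z \<in> P \<Longrightarrow> z \<in> ball (lam j) e0 \<Longrightarrow>
      branch 0 j z $ i = cut_pow \<eta> (z - lam j) (expo A1 j) * ser j i 0 (z - lam j)"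
    using ser_radius[of j 0 i] by blast
  have el: "exp (cut_log \<eta> (z - lam j)) = z - lam j" if "z \<in> P" for z
    using pole_notin_P[of j] that by (intro exp_cut_log) auto
  show ?thesis
  proof (cases "A1 $ j $ j \<in> \<int>")
    case False
    have "Psi_sing j z $ i = singular j i 0 (cut_log \<eta> (z - lam j)) + 0"
      if z: "z \<in> P" "z \<in> ball (lam j) e0" for z
    proof -
      have "Psi_sing j z = branch 0 j z"
        using sing[of j] False z(1) Psi_eq_branch by (simp add: is_Psi_sing_def)
      then show ?thesis
        using b[OF z] False el[OF z(1)] by (simp add: singular_def cut_pow_def)
    qed
    then show ?thesis using e0 by (intro exI[of _ "\<lambda>_. 0"] exI[of _ e0]) simp
  next
    case True
    \<comment> \<open>Otherwise the exponent is a negative integer other than -1 and the singular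
      solution is identically zero, and then the connection coefficient is zero by
      convention.\<close>
    have "log_solution lam A1 \<eta> F j (Psi j) (Psi_sing j)"
    proof (rule ccontr)
      assume no: "\<not> log_solution lam A1 \<eta> F j (Psi j) (Psi_sing j)"
      then have *: "A1 $ j $ j \<notin> \<nat>" "A1 $ j $ j \<noteq> -1" "\<And>z. z \<in> P \<Longrightarrow> Psi_sing j z = 0"
        using sing[of j] True by (auto simp: is_Psi_sing_def split: if_splits)
      have "A1 $ j $ j \<in> negative_Ints"
      proof -
        obtain n where n: "A1 $ j $ j = of_int n" using True by (auto elim: Ints_cases)
        have "n < 0"
        proof (rule ccontr)
          assume "\<not> n < 0"
          then have "A1 $ j $ j = of_nat (nat n)" using n by simp
          with *(1) show False using of_nat_in_Nats by metis
        qed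
        with n show ?thesis unfolding negative_Ints_def by blast
      qed
      with * conn have "c j k = 0" unfolding connection_coeffs_def by blast
      with cj show False ..
    qed
    then have eq: "eq_mod_reg P (lam j) (Psi_sing j) (\<lambda>z. cut_log \<eta> (z - lam j) *s Psi j z
              + (if A1 $ j $ j \<in> \<nat> then polar_part lam A1 F j z else 0))"
      by (simp add: log_solution_def)
    obtain R e1 where R: "R analytic_on {lam j}" "e1 > 0"
      "\<And>z. z \<in> P \<Longrightarrow> z \<in> ball (lam j) e1 \<Longrightarrow> Psi_sing j z $ i = (cut_log \<eta> (z - lam j) *s Psi j z
              + (if A1 $ j $ j \<in> \<nat> then polar_part lam A1 F j z else 0)) $ i + R z"
      using eq_mod_reg_nth[OF eq, of i] by blast
    have pol: "(if A1 $ j $ j \<in> \<nat> then polar_part lam A1 F j z else 0) $ i = polar j i 0 (z - lam j)"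
      if z: "z \<in> P" for z
    proof (cases "A1 $ j $ j \<in> \<nat>")
      case nat: True
      define N where "N = nat (NN A1 j)"
      have N: "NN A1 j = int N"
        using nat by (auto simp: N_def NN_def elim!: Nats_cases)
      have "nat (NN A1 j + 1 - int 0) = Suc N" using N by simp
      have x: "z - lam j \<noteq> 0" using z pole_notin_P[of j] by auto
      have "1 / (z - lam j) ^ (N + 1) * (fact (N - l) * (z - lam j) ^ l * fcol F j l $ i)
          = fact (N - l) * fcol F j l $ i / (z - lam j) ^ (Suc N - l)" if "l \<le> N" for l
      proof -
        have "(z - lam j) ^ (N + 1) = (z - lam j) ^ (Suc N - l) * (z - lam j) ^ l"
          using that by (simp flip: power_add)
        then show ?thesis using x by (simp add: field_simps)
      qed
      then have "(\<Sum>l\<le>N. 1 / (z - lam j) ^ (N + 1) * (fact (N - l) * (z - lam j) ^ l * fcol F j l $ i))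
          = (\<Sum>l\<le>N. fact (N - l) * fcol F j l $ i / (z - lam j) ^ (Suc N - l))"
        by (intro sum.cong) simp_all
      moreover have "polar_part lam A1 F j z $ i
          = (\<Sum>l\<le>N. 1 / (z - lam j) ^ (N + 1) * (fact (N - l) * (z - lam j) ^ l * fcol F j l $ i))"
        unfolding polar_part_def N_def[symmetric] atLeast0AtMost by (simp add: sum_distrib_left)
      moreover have "polar j i 0 (z - lam j)
          = (\<Sum>l\<le>N. fact (N - l) * fcol F j l $ i / (z - lam j) ^ (Suc N - l))"
        unfolding polar_def \<open>nat (NN A1 j + 1 - int 0) = Suc N\<close> lessThan_Suc_atMost by simp
      ultimately show ?thesis using nat by simp
    next
      case nat: False
      \<comment> \<open>For a negative integer exponent \<open>polar\<close> at level 0 is an empty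
        sum, in accordance with the absence of polar terms in the logarithmic solution.\<close>
      have "NN A1 j < 0"
      proof (rule ccontr)
        assume "\<not> NN A1 j < 0"
        then have "A1 $ j $ j = of_nat (nat (NN A1 j))" using NN_eq[OF True] by simp
        with nat show False using of_nat_in_Nats by metis
      qed
      then show ?thesis using nat by (simp add: polar_def)
    qed
    have "Psi_sing j z $ i = singular j i 0 (cut_log \<eta> (z - lam j)) + R z"
      if z: "z \<in> P" "z \<in> ball (lam j) (min e0 e1)" for z
    proof -
      have z0: "z \<in> ball (lam j) e0" and z1: "z \<in> ball (lam j) e1" using z(2) by auto
      have "Psi j z $ i = ser j i 0 (z - lam j)"
        using b[OF z(1) z0] Psi_eq_branch[OF z(1)] True by (simp add: expo_def)
      then show ?thesis
        using R(3)[OF z(1) z1] pol[OF z(1)] el[OF z(1)] True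
        by (simp only: vector_add_component vector_smult_component singular_def if_True)
    qed
    then show ?thesis using R(1,2) e0 by (intro exI[of _ R] exI[of _ "min e0 e1"]) simp
  qed
qed

lemma Psi_local_form:
  "\<exists>R e. R analytic_on {lam j} \<and> 0 < e \<and> (\<forall>z\<in>P \<inter> ball (lam j) e.
      branch 0 k z $ i = c j k * singular j i 0 (cut_log \<eta> (z - lam j)) + R z)"
proof -
  have eq: "eq_mod_reg P (lam j) (Psi k) (\<lambda>z. c j k *s Psi_sing j z)"
    using conn unfolding connection_coeffs_def by blast
  obtain R0 e0 where R0: "R0 analytic_on {lam j}" "e0 > 0"
      "\<And>z. z \<in> P \<Longrightarrow> z \<in> ball (lam j) e0 \<Longrightarrow> Psi k z $ i = (c j k *s Psi_sing j z) $ i + R0 z"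
    using eq_mod_reg_nth[OF eq, of i] by blast
  show ?thesis
  proof (cases "c j k = 0")
    case True
    with R0 Psi_eq_branch show ?thesis by (intro exI[of _ R0] exI[of _ e0]) simp
  next
    case False
    obtain R1 e1 where R1: "R1 analytic_on {lam j}" "e1 > 0"
      "\<And>z. z \<in> P \<Longrightarrow> z \<in> ball (lam j) e1 \<Longrightarrow>
        Psi_sing j z $ i = singular j i 0 (cut_log \<eta> (z - lam j)) + R1 z"
      using Psi_sing_local_form[OF False, of i] by blast
    define R where "R = (\<lambda>z. c j k * R1 z + R0 z)"
    have "R analytic_on {lam j}"
      unfolding R_def by (intro analytic_intros R0(1) R1(1))
    moreover have "branch 0 k z $ i = c j k * singular j i 0 (cut_log \<eta> (z - lam j)) + R z"
      if z: "z \<in> P" "z \<in> ball (lam j) (min e0 e1)" for z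
    proof -
      have z0: "z \<in> ball (lam j) e0" and z1: "z \<in> ball (lam j) e1" using z(2) by auto
      show ?thesis
        using R0(3)[OF z(1) z0] R1(3)[OF z(1) z1] Psi_eq_branch[OF z(1), of k]
        by (simp add: R_def distrib_left)
    qed
    ultimately show ?thesis using R0(2) R1(2) by (intro exI[of _ R] exI[of _ "min e0 e1"]) simp
  qed
qed

text \<open>Induction on \<open>p\<close>. What is carried along is that the part besides
  \<open>singular\<close> is a function of \<open>exp w\<close> regular at the pole: the correction
  \<open>B\<close> has this form, integrating against \<open>exp w\<close> is integrating in the
  variable \<open>exp w\<close>, and a constant of integration is of the same kind.\<close>

lemma lift_local_form:
  assumes r: "r > 0" and disj: "\<And>m. m \<noteq> j \<Longrightarrow> ball (lam j) r \<inter> cut lam \<eta> m = {}"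
    and hol: "\<And>p i. \<Phi> p i holomorphic_on {w. Re w < ln r}"
    and strip: "\<And>p i w. w \<in> strip \<eta> (ln r) \<Longrightarrow> \<Phi> p i w = branch p k (lam j + exp w) $ i"
    and der: "\<And>p i w. Re w < ln r \<Longrightarrow> (\<Phi> (Suc p) i has_field_derivative exp w * \<Phi> p i w) (at w)"
  shows "\<exists>e g. 0 < e \<and> e \<le> r \<and> g holomorphic_on ball 0 e \<and>
    (\<forall>w. Re w < ln e \<longrightarrow> \<Phi> p i w = c j k * singular j i p w + g (exp w))"
proof (induction p)
  case 0
  obtain R e1 where R: "R analytic_on {lam j}" "e1 > 0"
    "\<And>z. z \<in> P \<Longrightarrow> z \<in> ball (lam j) e1 \<Longrightarrow>
      branch 0 k z $ i = c j k * singular j i 0 (cut_log \<eta> (z - lam j)) + R z"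
    using Psi_local_form[of j k i] by blast
  obtain e2 where e2: "e2 > 0" "R holomorphic_on ball (lam j) e2"
    using R(1) by (auto simp: analytic_on_def)
  obtain e3 where e3: "e3 > 0" "\<And>x. norm x < e3 \<Longrightarrow> summable (\<lambda>l. coef A1 F j 0 l $ i * x ^ l)"
    using ser_radius[of j 0 i] by blast
  \<comment> \<open>The radius has to serve four purposes: the local form of
    \<open>\<Psi>\<^sub>k\<close>, holomorphy of the regular part, convergence of the series, and
    inclusion in the disc of the lift.\<close>
  define e where "e = min (min e1 e2) (min e3 r)"
  have e: "e > 0" "e \<le> e1" "e \<le> e2" "e \<le> e3" "e \<le> r"
    using R(2) e2(1) e3(1) r by (auto simp: e_def)
  define g where "g = (\<lambda>x. R (lam j + x))"
  have g: "g holomorphic_on ball 0 e"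
  proof -
    have "(R \<circ> (\<lambda>x. lam j + x)) holomorphic_on ball 0 e"
    proof (rule holomorphic_on_compose_gen[OF _ e2(2)])
      show "(\<lambda>x. lam j + x) ` ball 0 e \<subseteq> ball (lam j) e2"
        using e(3) by (auto simp: dist_norm)
    qed (intro holomorphic_intros)
    then show ?thesis by (simp add: g_def o_def)
  qed
  have ln_e: "ln e \<le> ln r" using e(1,5) by simp
  \<comment> \<open>The local form is known on the strip, where \<open>cut_log\<close> inverts
    \<open>exp\<close>; the identity theorem carries it to the half-plane, which is what the
    translation needs.\<close>
  have "\<Phi> 0 i w = c j k * singular j i 0 w + g (exp w)" if w: "Re w < ln e" for w
  proof (rule analytic_continuation_open[where s = "strip \<eta> (ln e)" and s' = "{w. Re w < ln e}"
        and f = "\<Phi> 0 i" and g = "\<lambda>w. c j k * singular j i 0 w + g (exp w)"])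
    show "open {w. Re w < ln e}" "connected {w. Re w < ln e}"
      using open_convex_half_plane convex_connected by blast+
    show "strip \<eta> (ln e) \<subseteq> {w. Re w < ln e}" by (auto simp: strip_def)
    show "\<Phi> 0 i holomorphic_on {w. Re w < ln e}"
      using ln_e by (intro holomorphic_on_subset[OF hol]) auto
    have "(g \<circ> exp) holomorphic_on {w. Re w < ln e}"
      by (rule holomorphic_on_compose_gen[OF _ g]) (use norm_exp_less[OF _ e(1)] in \<open>auto intro!: holomorphic_intros\<close>)
    moreover have "singular j i 0 holomorphic_on {w. Re w < ln e}"
      by (rule singular_holomorphic[OF _ e(1)]) (use e3(2) e(4) in auto)
    ultimately show "(\<lambda>w. c j k * singular j i 0 w + g (exp w)) holomorphic_on {w. Re w < ln e}"
      by (intro holomorphic_intros) (simp_all add: o_def)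
  next
    fix v assume v: "v \<in> strip \<eta> (ln e)"
    then have v': "v \<in> strip \<eta> (ln r)" using ln_e by (auto simp: strip_def)
    have inP: "lam j + exp v \<in> P" using exp_strip_mem_cut_plane[OF v' r disj] by blast
    have "lam j + exp v \<in> ball (lam j) e1"
      using norm_exp_less[OF _ e(1), of v] v e(2) by (auto simp: strip_def dist_norm)
    from R(3)[OF inP this] show "\<Phi> 0 i v = c j k * singular j i 0 v + g (exp v)"
      using strip[OF v', of 0 i] cut_log_exp[of \<eta> v] v by (simp add: g_def strip_def)
  qed (use w open_strip strip_nonempty in auto)
  with e g show ?case by blast
next
  case (Suc p)
  then obtain e1 g where IH: "0 < e1" "e1 \<le> r" "g holomorphic_on ball 0 e1"
    "\<And>w. Re w < ln e1 \<Longrightarrow> \<Phi> p i w = c j k * singular j i p w + g (exp w)" by blast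
  obtain e2 where e2: "e2 > 0" "\<And>x. norm x < e2 \<Longrightarrow> summable (\<lambda>l. coef A1 F j (Suc p) l $ i * x ^ l)"
    using ser_radius[of j "Suc p" i] by blast
  define e where "e = min e1 e2"
  have e: "e > 0" "e \<le> e1" "e \<le> e2" "e \<le> r" using IH e2 by (auto simp: e_def)
  have ln_e: "ln e \<le> ln e1" "ln e \<le> ln r" using e IH(1) by simp_all
  have conv: "\<And>x. norm x < e \<Longrightarrow> summable (\<lambda>l. coef A1 F j (Suc p) l $ i * x ^ l)"
    using e2(2) e(3) by simp
  obtain B where B: "B holomorphic_on ball 0 e" "\<And>w. Re w < ln e \<Longrightarrow>
      (singular j i (Suc p) has_field_derivative exp w * (singular j i p w + B (exp w))) (at w)"
    using has_field_derivative_singular[OF conv e(1)] by blast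
  have "g holomorphic_on ball 0 e"
    using IH(3) e(2) by (auto intro: holomorphic_on_subset)
  with B(1) have "(\<lambda>x. g x - c j k * B x) holomorphic_on ball 0 e"
    by (intro holomorphic_intros)
  \<comment> \<open>A primitive in the variable \<open>exp w\<close>; subtracting \<open>B\<close>
    compensates the regular term that arises when \<open>singular\<close> is differentiated.\<close>
  then obtain G where G: "\<And>x. x \<in> ball 0 e \<Longrightarrow> (G has_field_derivative g x - c j k * B x) (at x)"
    using primitive_vanishing_at[OF convex_ball open_ball] by blast
  obtain w0 where w0: "Re w0 < ln e" using that[of "of_real (ln e - 1)"] by simp
  \<comment> \<open>The constant of integration, fixed at \<open>w0\<close>. It is absorbed into the
    regular part.\<close>
  define C where "C = \<Phi> (Suc p) i w0 - (c j k * singular j i (Suc p) w0 + G (exp w0))"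
  have "\<Phi> (Suc p) i w = c j k * singular j i (Suc p) w + (G (exp w) + C)" if w: "Re w < ln e" for w
  proof (rule eq_of_same_derivative[where S = "{w. Re w < ln e}" and ?w0.0 = w0
        and f = "\<Phi> (Suc p) i" and g = "\<lambda>w. c j k * singular j i (Suc p) w + (G (exp w) + C)"
        and d = "\<lambda>v. exp v * (c j k * singular j i p v + g (exp v))"])
    fix v assume v: "v \<in> {w. Re w < ln e}"
    then have "(\<Phi> (Suc p) i has_field_derivative exp v * \<Phi> p i v) (at v)"
      using ln_e der by simp
    moreover have "\<Phi> p i v = c j k * singular j i p v + g (exp v)"
      using v ln_e IH(4) by simp
    ultimately show "(\<Phi> (Suc p) i has_field_derivative exp v * (c j k * singular j i p v + g (exp v))) (at v)"
      by simp
    have "exp v \<in> ball 0 e" using norm_exp_less[OF _ e(1), of v] v by simp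
    then have "((\<lambda>w. G (exp w)) has_field_derivative (g (exp v) - c j k * B (exp v)) * exp v) (at v)"
      using DERIV_chain2[OF G DERIV_exp] by blast
    moreover have "(singular j i (Suc p) has_field_derivative exp v * (singular j i p v + B (exp v))) (at v)"
      using B(2) v by simp
    ultimately have "((\<lambda>w. c j k * singular j i (Suc p) w + (G (exp w) + C)) has_field_derivative
        c j k * (exp v * (singular j i p v + B (exp v))) + ((g (exp v) - c j k * B (exp v)) * exp v + 0)) (at v)"
      by (intro DERIV_add DERIV_cmult DERIV_const)
    moreover have "c j k * (exp v * (singular j i p v + B (exp v))) + ((g (exp v) - c j k * B (exp v)) * exp v + 0)
        = exp v * (c j k * singular j i p v + g (exp v))"
      by (simp add: algebra_simps)
    ultimately show "((\<lambda>w. c j k * singular j i (Suc p) w + (G (exp w) + C)) has_field_derivative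
        exp v * (c j k * singular j i p v + g (exp v))) (at v)" by simp
  qed (use w w0 open_convex_half_plane in \<open>auto simp: C_def\<close>)
  moreover have "(\<lambda>x. G x + C) holomorphic_on ball 0 e"
    using G by (intro holomorphic_intros holomorphic_onI)
      (auto simp: field_differentiable_def intro: has_field_derivative_at_within)
  ultimately show ?case using e by blast
qed

text \<open>In the local form of the lift the regular part depends on \<open>exp w\<close> only and
  is invariant under translation by 2 pi i, so the increment is \<open>c j k\<close> times that of
  \<open>singular\<close>, and this is \<open>alpha A1 j\<close> times the primitive of the same
  level at \<open>\<lambda>\<^sub>j\<close>.\<close>

lemma loop_transform_branch:
  assumes loop: "small_loop lam \<eta> j \<gamma>"
  shows "loop_transform P \<gamma> (branch p k) (\<lambda>z. branch p k z + (alpha A1 j * c j k) *s branch p j z)"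
proof -
  obtain r where r: "r > 0" and disj: "\<And>m. m \<noteq> j \<Longrightarrow> ball (lam j) r \<inter> cut lam \<eta> m = {}"
    and img: "path_image \<gamma> \<subseteq> ball (lam j) r - {lam j}"
    using loop unfolding small_loop_def by blast
  obtain \<Phi> :: "nat \<Rightarrow> 'n \<Rightarrow> complex \<Rightarrow> complex"
    where lift: "\<forall>p i. \<Phi> p i holomorphic_on {w. Re w < ln r} \<and>
      (\<forall>w\<in>strip \<eta> (ln r). \<Phi> p i w = branch p k (lam j + exp w) $ i) \<and>
      (\<forall>w\<in>{w. Re w < ln r}. (\<Phi> (Suc p) i has_field_derivative exp w * \<Phi> p i w) (at w))"
    using branch_lift[OF r disj, of k] by blast
  have hol: "\<Phi> p i holomorphic_on {w. Re w < ln r}" for p i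
    using lift by simp
  have strip: "\<Phi> p i w = branch p k (lam j + exp w) $ i" if "w \<in> strip \<eta> (ln r)" for p i w
    using lift that by simp
  have der: "(\<Phi> (Suc p) i has_field_derivative exp w * \<Phi> p i w) (at w)" if "Re w < ln r" for p i w
    using lift that by simp
  define T where "T = 2 * of_real pi * \<i>"
  have inP: "lam j + exp w \<in> P" if "w \<in> strip \<eta> (ln r)" for w
    using exp_strip_mem_cut_plane[OF that r disj] by blast
  have mono: "\<Phi> p i (w + T) = \<Phi> p i w + alpha A1 j * c j k * branch p j (lam j + exp w) $ i"
    if w: "w \<in> strip \<eta> (ln r)" for i w
  proof -
    obtain e1 g where e1: "0 < e1" "e1 \<le> r" "g holomorphic_on ball 0 e1"
      "\<And>w. Re w < ln e1 \<Longrightarrow> \<Phi> p i w = c j k * singular j i p w + g (exp w)"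
      using lift_local_form[where \<Phi> = \<Phi> and p = p and i = i, OF r disj hol strip der] by blast
    obtain e2 where e2: "e2 > 0" "\<And>z. z \<in> P \<Longrightarrow> z \<in> ball (lam j) e2 \<Longrightarrow>
        branch p j z $ i = cut_pow \<eta> (z - lam j) (expo A1 j) * ser j i p (z - lam j)"
      using ser_radius[of j p i] by blast
    \<comment> \<open>Local form and series hold only in this smaller disc, whereas the loop is
      confined merely to the disc of radius \<open>r\<close>. The identity theorem therefore extends
      the formula from the smaller strip to the larger one.\<close>
    define e where "e = min e1 e2"
    have e: "e > 0" "e \<le> e1" "e \<le> e2" "e \<le> r" using e1 e2 by (auto simp: e_def)
    have ln_e: "ln e \<le> ln e1" "ln e \<le> ln r" using e e1(1) by simp_all
    show ?thesis
    proof (rule analytic_continuation_open[where s = "strip \<eta> (ln e)" and s' = "strip \<eta> (ln r)"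
          and f = "\<lambda>w. \<Phi> p i (w + T)"
          and g = "\<lambda>w. \<Phi> p i w + alpha A1 j * c j k * branch p j (lam j + exp w) $ i"])
      show "connected (strip \<eta> (ln r))" by (rule convex_connected[OF convex_strip])
      show "strip \<eta> (ln e) \<subseteq> strip \<eta> (ln r)" using ln_e by (auto simp: strip_def)
      have "(\<Phi> p i \<circ> (\<lambda>w. w + T)) holomorphic_on strip \<eta> (ln r)"
        by (rule holomorphic_on_compose_gen[OF _ hol])
          (auto intro!: holomorphic_intros simp: strip_def T_def)
      then show "(\<lambda>w. \<Phi> p i (w + T)) holomorphic_on strip \<eta> (ln r)" by (simp add: o_def)
      have "((\<lambda>z. branch p j z $ i) \<circ> (\<lambda>w. lam j + exp w)) holomorphic_on strip \<eta> (ln r)"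
        by (rule holomorphic_on_compose_gen[OF _ branch_holomorphic])
          (use inP in \<open>auto intro!: holomorphic_intros\<close>)
      moreover have "\<Phi> p i holomorphic_on strip \<eta> (ln r)"
        by (rule holomorphic_on_subset[OF hol]) (auto simp: strip_def)
      ultimately show "(\<lambda>w. \<Phi> p i w + alpha A1 j * c j k * branch p j (lam j + exp w) $ i)
          holomorphic_on strip \<eta> (ln r)"
        by (intro holomorphic_intros) (simp_all add: o_def)
    next
      fix v assume v: "v \<in> strip \<eta> (ln e)"
      then have v': "v \<in> strip \<eta> (ln r)" using ln_e by (auto simp: strip_def)
      have "lam j + exp v \<in> ball (lam j) e2"
        using norm_exp_less[OF _ e(1), of v] v e(3) by (auto simp: strip_def dist_norm)
      from e2(2)[OF inP[OF v'] this]
      have "branch p j (lam j + exp v) $ i = exp (expo A1 j * v) * ser j i p (exp v)"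
        using cut_log_exp[of \<eta> v] v by (simp add: cut_pow_def strip_def)
      moreover have "\<Phi> p i v = c j k * singular j i p v + g (exp v)"
        using v ln_e by (intro e1(4)) (simp add: strip_def)
      moreover have "\<Phi> p i (v + T) = c j k * singular j i p (v + T) + g (exp (v + T))"
        using v ln_e by (intro e1(4)) (simp add: strip_def T_def)
      moreover have "exp (v + T) = exp v" by (simp add: T_def exp_add)
      moreover have "singular j i p (v + T) = singular j i p v + alpha A1 j * (exp (expo A1 j * v) * ser j i p (exp v))"
        using singular_monodromy[of j i p v] unfolding T_def by (simp only: diff_eq_eq add.commute)
      ultimately show "\<Phi> p i (v + T) = \<Phi> p i v + alpha A1 j * c j k * branch p j (lam j + exp v) $ i"
        by (simp add: algebra_simps)
    qed (use w open_strip strip_nonempty in auto)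
  qed
  show ?thesis
  proof (rule loop_transform_lift[where r = r and j = j and \<Phi> = "\<Phi> p"])
    show "(\<lambda>z. branch p k z + (alpha A1 j * c j k) *s branch p j z) vholomorphic_on P"
      unfolding vholomorphic_on_def using branch_holomorphic
      by (auto intro!: holomorphic_intros)
  qed (use loop img hol strip mono in \<open>auto simp: small_loop_def T_def\<close>)
qed

end

section \<open>Both cases read off from the statement for primitives of
  \<open>\<Psi>\<^sub>k\<close>\<close>

theorem proposition12:
  fixes lam :: "'n::finite \<Rightarrow> complex"
    and A1 :: "complex^'n^'n"
    and \<eta> :: real
    and F :: "complex fps^'n^'n"
    and Psi Psi_sing :: "'n \<Rightarrow> complex \<Rightarrow> complex^'n"
    and Psi_prim hat :: "nat \<Rightarrow> 'n \<Rightarrow> complex \<Rightarrow> complex^'n"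
    and c :: "'n \<Rightarrow> 'n \<Rightarrow> complex"
    and q :: nat and j k :: 'n and \<gamma> :: "real \<Rightarrow> complex"
  assumes "inj lam"
    and "admissible lam \<eta>"
    and "formal_solution lam A1 F"
    and "\<And>m. A1 $ m $ m = -1 \<Longrightarrow> has_nontrivial_jordan_block (residue_mat A1 m)"
    and "\<And>m. is_Psi lam A1 \<eta> F m (Psi m)"
    and "\<And>m. is_Psi_sing lam A1 \<eta> F m (Psi m) (Psi_sing m)"
    and "connection_coeffs lam A1 \<eta> Psi Psi_sing c"
    and "\<And>p m. A1 $ m $ m \<notin> \<nat> \<Longrightarrow> is_Psi_prim lam A1 \<eta> F p m (Psi_prim p m)"
    and "\<And>p m. A1 $ m $ m \<in> \<nat> \<Longrightarrow> is_hat_prim lam A1 \<eta> F p m (hat p m)"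
    and "small_loop lam \<eta> j \<gamma>"
  shows
    "(A1 $ k $ k \<notin> \<int> \<or> A1 $ k $ k \<in> negative_Ints \<longrightarrow>
        loop_transform (cut_plane lam \<eta>) \<gamma> (Psi_prim q k)
          (\<lambda>z. Psi_prim q k z + (alpha A1 j * c j k) *s
             (if A1 $ j $ j \<in> \<nat> then hat_bracket hat j (- int q + NN A1 j + 1) z
              else Psi_prim q j z))) \<and>
     (A1 $ k $ k \<in> \<nat> \<longrightarrow>
        loop_transform (cut_plane lam \<eta>) \<gamma> (hat q k)
          (\<lambda>z. hat q k z + (alpha A1 j * c j k) *s
             (if A1 $ j $ j \<in> \<nat> then hat_bracket hat j (- int q + NN A1 j - NN A1 k) z
              else Psi_prim (q + 1 + nat (NN A1 k)) j z)))"
proof -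
  interpret connection_coefficients lam \<eta> A1 F Psi Psi_prim hat Psi_sing c
    by unfold_locales (fact assms)+
  note transform = loop_transform_branch[OF assms(10)]
  show ?thesis
  proof (intro conjI impI)
    assume k: "A1 $ k $ k \<notin> \<int> \<or> A1 $ k $ k \<in> negative_Ints"
    have "A1 $ k $ k \<notin> \<nat>"
    proof
      assume "A1 $ k $ k \<in> \<nat>"
      then obtain n where n: "A1 $ k $ k = of_nat n" by (auto elim: Nats_cases)
      then have "A1 $ k $ k \<in> \<int>" by simp
      with k obtain m where "m < 0" "(of_int m :: complex) = of_nat n"
        using n by (auto simp: negative_Ints_def)
      then have "(of_int m :: complex) = of_int (int n)" by simp
      with \<open>m < 0\<close> show False unfolding of_int_eq_iff by simp
    qed
    then have "branch q k = Psi_prim q k" by (simp add: branch_def)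
    moreover have "branch q j = (\<lambda>z. if A1 $ j $ j \<in> \<nat> then hat_bracket hat j (- int q + NN A1 j + 1) z
              else Psi_prim q j z)"
      by (simp add: branch_def algebra_simps)
    ultimately show "loop_transform P \<gamma> (Psi_prim q k)
          (\<lambda>z. Psi_prim q k z + (alpha A1 j * c j k) *s
             (if A1 $ j $ j \<in> \<nat> then hat_bracket hat j (- int q + NN A1 j + 1) z
              else Psi_prim q j z))"
      using transform[of q k] by simp
  next
    assume k: "A1 $ k $ k \<in> \<nat>"
    define N where "N = nat (NN A1 k)"
    have N: "NN A1 k = int N"
      using k by (auto simp: N_def NN_def elim!: Nats_cases)
    \<comment> \<open>The \<open>q\<close>-primitive of the hatted function is the primitive of
      order \<open>q + 1 + N\<close> of \<open>\<Psi>\<^sub>k\<close>. Taking the same order at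
      \<open>\<lambda>\<^sub>j\<close> produces the shifted superscripts of part (b).\<close>
    have "branch (q + 1 + N) k = hat q k"
      using k N by (simp add: branch_def hat_bracket_def)
    moreover have "branch (q + 1 + N) j =
        (\<lambda>z. if A1 $ j $ j \<in> \<nat> then hat_bracket hat j (- int q + NN A1 j - NN A1 k) z
              else Psi_prim (q + 1 + nat (NN A1 k)) j z)"
      using N by (simp add: branch_def algebra_simps)
    ultimately show "loop_transform P \<gamma> (hat q k)
          (\<lambda>z. hat q k z + (alpha A1 j * c j k) *s
             (if A1 $ j $ j \<in> \<nat> then hat_bracket hat j (- int q + NN A1 j - NN A1 k) z
              else Psi_prim (q + 1 + nat (NN A1 k)) j z))"
      using transform[of "q + 1 + N" k] by simp
  qed
qed

end
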